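(* Let $\mathscr{B}$ be a closed bicategory with a coshadow $\mathrm{Csh}$, and let $(P,Q)$, with $P\in\mathscr{B}(R,S)$ and $Q\in\mathscr{B}(S,R)$, be a Morita equivalence between 0-cells $R$ and $S$ of $\mathscr{B}$. Then for any 1-cell $M\in\mathscr{B}(R,R)$ there is an isomorphism $$\mathrm{Csh}(M)\cong\mathrm{Csh}(Q\odot M\odot P),$$ and moreover there is a bicategorical cotrace witnessing this equivalence: there exist a right dualizable 1-cell $N\in\mathscr{B}(S,R)$ and a 2-cell $f:N\triangleright M\to(Q\odot M\odot P)\triangleleft N$ whose cotrace $\mathrm{cotr}_N(f):\mathrm{Csh}(M)\to\mathrm{Csh}(Q\odot M\odot P)$ is an isomorphism.
   Context: **Bicategories.** $\mathscr{B}(R,S)$ is the category of 1-cells $M:R\to S$ and 2-cells between them. Composition of 1-cells $\odot:\mathscr{B}(R,S)\times\mathscr{B}(S,T)\to\mathscr{B}(R,T)$ is written in diagrammatic order; $U_R$ is the identity 1-cell; $l:U_R\odot M\to M$ and $r:M\odot U_S\to M$ are the unitors for $M:R\to S$. Associators for $\odot$ are suppressed. **Closed bicategory.** A bicategory with functors $-\triangleleft-:\mathscr{B}(R,T)\times\mathscr{B}(R,S)^{\mathrm{op}}\to\mathscr{B}(S,T)$ and $-\triangleright-:\mathscr{B}(S,T)^{\mathrm{op}}\times\mathscr{B}(R,T)\to\mathscr{B}(R,S)$ and natural isomorphisms $\mathscr{B}(S,T)(N,P\triangleleft M)\cong\mathscr{B}(R,T)(M\odot N,P)\cong\mathscr{B}(R,S)(M,N\triangleright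 P)$ for $M:R\to S$, $N:S\to T$, $P:R\to T$. Corresponding 2-cells are called transposes of each other. The evaluations $\mathrm{ev}:(N\triangleright P)\odot N\to P$ and $\mathrm{ev}:M\odot(P\triangleleft M)\to P$ are the transposes of identities. For a 2-cell $h$, $h_*$ (resp. $h^*$) is the map induced on hom-objects by covariance in the target (resp. contravariance in the source). **Canonical isomorphisms.** $t:(M\odot N)\triangleright P\to M\triangleright(N\triangleright P)$ is the transpose of the transpose of $\mathrm{ev}:((M\odot N)\triangleright P)\odot M\odot N\to P$; similarly $t:P\triangleleft(M\odot N)\to(P\triangleleft M)\triangleleft N$. The isomorphism $a:(N\triangleright P)\triangleleft M\to N\triangleright(P\triangleleft M)$ is the map whose transpose with respect to both $N$ and $M$ is $M\odot((N\triangleright P)\triangleleft M)\odot N\xrightarrow{\mathrm{ev}\odot1}(N\triangleright P)\odot N\xrightarrow{\mathrm{ev}}P$. For $M:R\to S$, $\overline{l}:M\to M\triangleleft U_R$ is the transpose of $l$ and $\overline{r}:M\to U_S\triangleright M$ is the transpose of $r$; both are isomorphisms. **Duality.** $M\in\mathscr{B}(R,S)$ is right dualizable if there are $M^*\in\mathscr{B}(S,R)$ and 2-cells $\eta:U_R\to M\odot M^*$, $\varepsilon:M^*\odot M\to U_S$ with $(1_M\odot\varepsilon)(\eta\odot 1_M)=1_M$ and $(\varepsilon\odot1_{M^*})(1_{M^*}\odot\eta)=1_{M^*}$ (the triangle identities); $(M,M^* )$ is then a dual pair. **Morita equivalence.** A Morita equivalence between 0-cells $R$ and $S$ is a pair $(P,Q)$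 of 1-cells $P\in\mathscr{B}(R,S)$, $Q\in\mathscr{B}(S,R)$ together with isomorphisms $\eta:U_R\to P\odot Q$ and $\varepsilon:Q\odot P\to U_S$ satisfying the triangle identities. **Coshadow.** A coshadow on a closed bicategory with target category $\mathbf{T}$: functors $\mathrm{Csh}:\mathscr{B}(R,R)\to\mathbf{T}$ for each $R$ and natural isomorphisms $\theta:\mathrm{Csh}(M\triangleright N)\to\mathrm{Csh}(N\triangleleft M)$ for $M,N\in\mathscr{B}(R,S)$ (inverses are also denoted $\theta$), such that for $M:R\to S$, $N:S\to T$, $P:R\to T$ the composites $\mathrm{Csh}((M\odot N)\triangleright P)\xrightarrow{\theta}\mathrm{Csh}(P\triangleleft(M\odot N))\xrightarrow{\mathrm{Csh}(t)}\mathrm{Csh}((P\triangleleft M)\triangleleft N)\xrightarrow{\theta}\mathrm{Csh}(N\triangleright(P\triangleleft M))$ and $\mathrm{Csh}((M\odot N)\triangleright P)\xrightarrow{\mathrm{Csh}(t)}\mathrm{Csh}(M\triangleright(N\triangleright P))\xrightarrow{\theta}\mathrm{Csh}((N\triangleright P)\triangleleft M)\xrightarrow{\mathrm{Csh}(a)}\mathrm{Csh}(N\triangleright(P\triangleleft M))$ agree, and for $M\in\mathscr{B}(R,R)$, $\mathrm{Csh}(\overline{l}^{-1})\circ\theta=\mathrm{Csh}(\overline{r}^{-1}):\mathrm{Csh}(U_R\triangleright M)\to\mathrm{Csh}(M)$. **Cotrace.** For a dual pair $(M,M^* )$ with $M:R\to S$ and $f:M\triangleright Q\to P\triangleleft M$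 with $Q:S\to S$, $P:R\to R$, $\mathrm{cotr}_M(f):\mathrm{Csh}(Q)\to\mathrm{Csh}(P)$ is the composite of $\mathrm{Csh}$ of the evident maps (and $\theta$): $$Q\xrightarrow{\overline{r}}U_S\triangleright Q\xrightarrow{\varepsilon^*}(M^*\odot M)\triangleright Q\xrightarrow{t}M^*\triangleright(M\triangleright Q)\xrightarrow{f_*}M^*\triangleright(P\triangleleft M),$$ $$\theta:\mathrm{Csh}(M^*\triangleright(P\triangleleft M))\to\mathrm{Csh}((P\triangleleft M)\triangleleft M^* ),$$ $$(P\triangleleft M)\triangleleft M^*\xrightarrow{t^{-1}}P\triangleleft(M\odot M^* )\xrightarrow{\eta^*}P\triangleleft U_R\xrightarrow{\overline{l}^{-1}}P.$$ *)

theory Defs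
  imports Main
begin

section \<open>Categories\<close>

record ('a, 'f) cat =
  Ob :: "'a set"
  Ar :: "'f set"
  Dom :: "'f \<Rightarrow> 'a"
  Cod :: "'f \<Rightarrow> 'a"
  idt :: "'a \<Rightarrow> 'f" ("\<one>\<index>")
  cmp :: "'f \<Rightarrow> 'f \<Rightarrow> 'f" (infixl "\<cdot>\<index>" 55)  \<comment> \<open>\<open>g \<cdot> f\<close> is \<open>f\<close> followed by \<open>g\<close>\<close>

definition Hom :: "('a, 'f, 'z) cat_scheme \<Rightarrow> 'a \<Rightarrow> 'a \<Rightarrow> 'f set" where
  "Hom C X Y = {f \<in> Ar C. Dom C f = X \<and> Cod C f = Y}"

locale category =
  fixes C :: "('a, 'f, 'z) cat_scheme" (structure)
  assumes dom_ob: "f \<in> Ar C \<Longrightarrow> Dom C f \<in> Ob C"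
    and cod_ob: "f \<in> Ar C \<Longrightarrow> Cod C f \<in> Ob C"
    and idt_hom: "X \<in> Ob C \<Longrightarrow> \<one> X \<in> Hom C X X"
    and cmp_hom: "\<lbrakk>f \<in> Hom C X Y; g \<in> Hom C Y Z\<rbrakk> \<Longrightarrow> g \<cdot> f \<in> Hom C X Z"
    and cmp_idt_left: "f \<in> Hom C X Y \<Longrightarrow> \<one> Y \<cdot> f = f"
    and cmp_idt_right: "f \<in> Hom C X Y \<Longrightarrow> f \<cdot> \<one> X = f"
    and cmp_assoc: "\<lbrakk>f \<in> Hom C W X; g \<in> Hom C X Y; h \<in> Hom C Y Z\<rbrakk>
      \<Longrightarrow> (h \<cdot> g) \<cdot> f = h \<cdot> (g \<cdot> f)"

definition Iso :: "('a, 'f, 'z) cat_scheme \<Rightarrow> 'a \<Rightarrow> 'a \<Rightarrow> 'f set" where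
  "Iso C X Y = {f \<in> Hom C X Y. \<exists>g \<in> Hom C Y X. g \<cdot>\<^bsub>C\<^esub> f = \<one>\<^bsub>C\<^esub> X \<and> f \<cdot>\<^bsub>C\<^esub> g = \<one>\<^bsub>C\<^esub> Y}"

definition isomorphic :: "('a, 'f, 'z) cat_scheme \<Rightarrow> 'a \<Rightarrow> 'a \<Rightarrow> bool" where
  "isomorphic C X Y \<longleftrightarrow> Iso C X Y \<noteq> {}"

text \<open>The inverse of an arrow; unspecified if the arrow is not an isomorphism.\<close>

definition Inv :: "('a, 'f, 'z) cat_scheme \<Rightarrow> 'f \<Rightarrow> 'f" where
  "Inv C f = (THE g. g \<in> Hom C (Cod C f) (Dom C f)
     \<and> g \<cdot>\<^bsub>C\<^esub> f = \<one>\<^bsub>C\<^esub> (Dom C f) \<and> f \<cdot>\<^bsub>C\<^esub> g = \<one>\<^bsub>C\<^esub> (Cod C f))"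


section \<open>Bicategories\<close>

text \<open>
  A bicategory extends the category whose objects are all 1-cells and whose arrows are all
  2-cells, i.e. the disjoint union of the hom-categories \<open>\<B>(R,S)\<close>, by 0-cells, by source
  and target 0-cells of 1-cells, and by the bicategorical structure.  Thus \<open>Ob B\<close> is the set
  of 1-cells, \<open>Hom B M N\<close> the set of 2-cells from \<open>M\<close> to \<open>N\<close>, and \<open>\<cdot>\<close> vertical composition.
  Horizontal composition is written in diagrammatic order, \<open>\<odot>\<close> on 1-cells and \<open>\<otimes>\<close> on
  2-cells.
\<close>

record ('o, 'm, 'c) bicat = "('m, 'c) cat" +
  Obj :: "'o set"
  src :: "'m \<Rightarrow> 'o"
  trg :: "'m \<Rightarrow> 'o"
  unit :: "'o \<Rightarrow> 'm" ("U\<index>")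
  hcmp1 :: "'m \<Rightarrow> 'm \<Rightarrow> 'm" (infixl "\<odot>\<index>" 70)
  hcmp2 :: "'c \<Rightarrow> 'c \<Rightarrow> 'c" (infixl "\<otimes>\<index>" 70)
  assoc :: "'m \<Rightarrow> 'm \<Rightarrow> 'm \<Rightarrow> 'c"
  lunit :: "'m \<Rightarrow> 'c"
  runit :: "'m \<Rightarrow> 'c"

definition Cell :: "('o, 'm, 'c, 'z) bicat_scheme \<Rightarrow> 'o \<Rightarrow> 'o \<Rightarrow> 'm set" where
  "Cell B R S = {M \<in> Ob B. src B M = R \<and> trg B M = S}"

locale bicategory = category B
  for B :: "('o, 'm, 'c, 'z) bicat_scheme" (structure) +
  assumes src_obj: "M \<in> Ob B \<Longrightarrow> src B M \<in> Obj B"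
    and trg_obj: "M \<in> Ob B \<Longrightarrow> trg B M \<in> Obj B"
    and parallel: "\<alpha> \<in> Hom B M N \<Longrightarrow> src B M = src B N \<and> trg B M = trg B N"
    and unit_cell: "R \<in> Obj B \<Longrightarrow> U R \<in> Cell B R R"
    and hcmp1_cell: "\<lbrakk>M \<in> Cell B R S; N \<in> Cell B S T\<rbrakk> \<Longrightarrow> M \<odot> N \<in> Cell B R T"
    and hcmp2_hom: "\<lbrakk>M \<in> Cell B R S; N \<in> Cell B S T; \<alpha> \<in> Hom B M M'; \<beta> \<in> Hom B N N'\<rbrakk>
      \<Longrightarrow> \<alpha> \<otimes> \<beta> \<in> Hom B (M \<odot> N) (M' \<odot> N')"
    and hcmp2_idt: "\<lbrakk>M \<in> Cell B R S; N \<in> Cell B S T\<rbrakk> \<Longrightarrow> \<one> M \<otimes> \<one> N = \<one> (M \<odot> N)"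
    and hcmp2_cmp: "\<lbrakk>M \<in> Cell B R S; N \<in> Cell B S T;
        \<alpha> \<in> Hom B M M'; \<alpha>' \<in> Hom B M' M''; \<beta> \<in> Hom B N N'; \<beta>' \<in> Hom B N' N''\<rbrakk>
      \<Longrightarrow> (\<alpha>' \<cdot> \<alpha>) \<otimes> (\<beta>' \<cdot> \<beta>) = (\<alpha>' \<otimes> \<beta>') \<cdot> (\<alpha> \<otimes> \<beta>)"
    and assoc_iso: "\<lbrakk>M \<in> Cell B R S; N \<in> Cell B S T; P \<in> Cell B T V\<rbrakk>
      \<Longrightarrow> assoc B M N P \<in> Iso B ((M \<odot> N) \<odot> P) (M \<odot> (N \<odot> P))"
    and assoc_natural: "\<lbrakk>M \<in> Cell B R S; N \<in> Cell B S T; P \<in> Cell B T V;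
        \<alpha> \<in> Hom B M M'; \<beta> \<in> Hom B N N'; \<gamma> \<in> Hom B P P'\<rbrakk>
      \<Longrightarrow> assoc B M' N' P' \<cdot> ((\<alpha> \<otimes> \<beta>) \<otimes> \<gamma>) = (\<alpha> \<otimes> (\<beta> \<otimes> \<gamma>)) \<cdot> assoc B M N P"
    and lunit_iso: "M \<in> Cell B R S \<Longrightarrow> lunit B M \<in> Iso B (U R \<odot> M) M"
    and lunit_natural: "\<lbrakk>M \<in> Cell B R S; \<alpha> \<in> Hom B M M'\<rbrakk>
      \<Longrightarrow> lunit B M' \<cdot> (\<one> (U R) \<otimes> \<alpha>) = \<alpha> \<cdot> lunit B M"
    and runit_iso: "M \<in> Cell B R S \<Longrightarrow> runit B M \<in> Iso B (M \<odot> U S) M"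
    and runit_natural: "\<lbrakk>M \<in> Cell B R S; \<alpha> \<in> Hom B M M'\<rbrakk>
      \<Longrightarrow> runit B M' \<cdot> (\<alpha> \<otimes> \<one> (U S)) = \<alpha> \<cdot> runit B M"
    and pentagon: "\<lbrakk>K \<in> Cell B R S; L \<in> Cell B S T; M \<in> Cell B T V; N \<in> Cell B V W\<rbrakk>
      \<Longrightarrow> (\<one> K \<otimes> assoc B L M N) \<cdot> assoc B K (L \<odot> M) N \<cdot> (assoc B K L M \<otimes> \<one> N)
        = assoc B K L (M \<odot> N) \<cdot> assoc B (K \<odot> L) M N"
    and triangle: "\<lbrakk>M \<in> Cell B R S; N \<in> Cell B S T\<rbrakk>
      \<Longrightarrow> (\<one> M \<otimes> lunit B N) \<cdot> assoc B M (U S) N = runit B M \<otimes> \<one> N"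


section \<open>Closed bicategories\<close>

text \<open>
  The hom functors are written \<open>\<triangleleft>\<close>, \<open>\<triangleright>\<close> on 1-cells and \<open>\<lhd>\<close>, \<open>\<rhd>\<close> on 2-cells.  The maps
  \<open>curryl M N P\<close> and \<open>curryr M N P\<close> are the two transposition bijections out of
  \<open>Hom B (M \<odot> N) P\<close>, onto \<open>Hom B N (P \<triangleleft> M)\<close> and \<open>Hom B M (N \<triangleright> P)\<close> respectively.
\<close>

record ('o, 'm, 'c) closed_bicat = "('o, 'm, 'c) bicat" +
  lhom1 :: "'m \<Rightarrow> 'm \<Rightarrow> 'm" (infix "\<triangleleft>\<index>" 65)
  lhom2 :: "'c \<Rightarrow> 'c \<Rightarrow> 'c" (infix "\<lhd>\<index>" 65)
  rhom1 :: "'m \<Rightarrow> 'm \<Rightarrow> 'm" (infix "\<triangleright>\<index>" 65)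
  rhom2 :: "'c \<Rightarrow> 'c \<Rightarrow> 'c" (infix "\<rhd>\<index>" 65)
  curryl :: "'m \<Rightarrow> 'm \<Rightarrow> 'm \<Rightarrow> 'c \<Rightarrow> 'c"
  curryr :: "'m \<Rightarrow> 'm \<Rightarrow> 'm \<Rightarrow> 'c \<Rightarrow> 'c"

locale closed_bicategory = bicategory B
  for B :: "('o, 'm, 'c, 'z) closed_bicat_scheme" (structure) +
  assumes lhom1_cell: "\<lbrakk>P \<in> Cell B R T; M \<in> Cell B R S\<rbrakk> \<Longrightarrow> P \<triangleleft> M \<in> Cell B S T"
    and lhom2_hom: "\<lbrakk>P \<in> Cell B R T; M \<in> Cell B R S; \<pi> \<in> Hom B P P'; \<mu> \<in> Hom B M' M\<rbrakk>
      \<Longrightarrow> \<pi> \<lhd> \<mu> \<in> Hom B (P \<triangleleft> M) (P' \<triangleleft> M')"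
    and lhom2_idt: "\<lbrakk>P \<in> Cell B R T; M \<in> Cell B R S\<rbrakk> \<Longrightarrow> \<one> P \<lhd> \<one> M = \<one> (P \<triangleleft> M)"
    and lhom2_cmp: "\<lbrakk>P \<in> Cell B R T; M \<in> Cell B R S;
        \<pi> \<in> Hom B P P'; \<pi>' \<in> Hom B P' P''; \<mu> \<in> Hom B M' M; \<mu>' \<in> Hom B M'' M'\<rbrakk>
      \<Longrightarrow> (\<pi>' \<cdot> \<pi>) \<lhd> (\<mu> \<cdot> \<mu>') = (\<pi>' \<lhd> \<mu>') \<cdot> (\<pi> \<lhd> \<mu>)"
    and rhom1_cell: "\<lbrakk>N \<in> Cell B S T; P \<in> Cell B R T\<rbrakk> \<Longrightarrow> N \<triangleright> P \<in> Cell B R S"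
    and rhom2_hom: "\<lbrakk>N \<in> Cell B S T; P \<in> Cell B R T; \<nu> \<in> Hom B N' N; \<pi> \<in> Hom B P P'\<rbrakk>
      \<Longrightarrow> \<nu> \<rhd> \<pi> \<in> Hom B (N \<triangleright> P) (N' \<triangleright> P')"
    and rhom2_idt: "\<lbrakk>N \<in> Cell B S T; P \<in> Cell B R T\<rbrakk> \<Longrightarrow> \<one> N \<rhd> \<one> P = \<one> (N \<triangleright> P)"
    and rhom2_cmp: "\<lbrakk>N \<in> Cell B S T; P \<in> Cell B R T;
        \<nu> \<in> Hom B N' N; \<nu>' \<in> Hom B N'' N'; \<pi> \<in> Hom B P P'; \<pi>' \<in> Hom B P' P''\<rbrakk>
      \<Longrightarrow> (\<nu> \<cdot> \<nu>') \<rhd> (\<pi>' \<cdot> \<pi>) = (\<nu>' \<rhd> \<pi>') \<cdot> (\<nu> \<rhd> \<pi>)"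
    and curryl_bij: "\<lbrakk>M \<in> Cell B R S; N \<in> Cell B S T; P \<in> Cell B R T\<rbrakk>
      \<Longrightarrow> bij_betw (curryl B M N P) (Hom B (M \<odot> N) P) (Hom B N (P \<triangleleft> M))"
    and curryl_natural: "\<lbrakk>M \<in> Cell B R S; N \<in> Cell B S T; P \<in> Cell B R T;
        \<mu> \<in> Hom B M' M; \<nu> \<in> Hom B N' N; \<pi> \<in> Hom B P P'; \<phi> \<in> Hom B (M \<odot> N) P\<rbrakk>
      \<Longrightarrow> curryl B M' N' P' (\<pi> \<cdot> \<phi> \<cdot> (\<mu> \<otimes> \<nu>)) = (\<pi> \<lhd> \<mu>) \<cdot> curryl B M N P \<phi> \<cdot> \<nu>"
    and curryr_bij: "\<lbrakk>M \<in> Cell B R S; N \<in> Cell B S T; P \<in> Cell B R T\<rbrakk>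
      \<Longrightarrow> bij_betw (curryr B M N P) (Hom B (M \<odot> N) P) (Hom B M (N \<triangleright> P))"
    and curryr_natural: "\<lbrakk>M \<in> Cell B R S; N \<in> Cell B S T; P \<in> Cell B R T;
        \<mu> \<in> Hom B M' M; \<nu> \<in> Hom B N' N; \<pi> \<in> Hom B P P'; \<phi> \<in> Hom B (M \<odot> N) P\<rbrakk>
      \<Longrightarrow> curryr B M' N' P' (\<pi> \<cdot> \<phi> \<cdot> (\<mu> \<otimes> \<nu>)) = (\<nu> \<rhd> \<pi>) \<cdot> curryr B M N P \<phi> \<cdot> \<mu>"

definition uncurryl ::
  "('o, 'm, 'c, 'z) closed_bicat_scheme \<Rightarrow> 'm \<Rightarrow> 'm \<Rightarrow> 'm \<Rightarrow> 'c \<Rightarrow> 'c" where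
  "uncurryl B M N P = the_inv_into (Hom B (M \<odot>\<^bsub>B\<^esub> N) P) (curryl B M N P)"

definition uncurryr ::
  "('o, 'm, 'c, 'z) closed_bicat_scheme \<Rightarrow> 'm \<Rightarrow> 'm \<Rightarrow> 'm \<Rightarrow> 'c \<Rightarrow> 'c" where
  "uncurryr B M N P = the_inv_into (Hom B (M \<odot>\<^bsub>B\<^esub> N) P) (curryr B M N P)"

text \<open>\<open>evl B M P : M \<odot> (P \<triangleleft> M) \<rightarrow> P\<close> and \<open>evr B N P : (N \<triangleright> P) \<odot> N \<rightarrow> P\<close>.\<close>

definition evl :: "('o, 'm, 'c, 'z) closed_bicat_scheme \<Rightarrow> 'm \<Rightarrow> 'm \<Rightarrow> 'c" where
  "evl B M P = uncurryl B M (P \<triangleleft>\<^bsub>B\<^esub> M) P (\<one>\<^bsub>B\<^esub> (P \<triangleleft>\<^bsub>B\<^esub> M))"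

definition evr :: "('o, 'm, 'c, 'z) closed_bicat_scheme \<Rightarrow> 'm \<Rightarrow> 'm \<Rightarrow> 'c" where
  "evr B N P = uncurryr B (N \<triangleright>\<^bsub>B\<^esub> P) N P (\<one>\<^bsub>B\<^esub> (N \<triangleright>\<^bsub>B\<^esub> P))"

text \<open>
  The canonical isomorphisms
  \<open>tright B M N P : (M \<odot> N) \<triangleright> P \<rightarrow> M \<triangleright> (N \<triangleright> P)\<close>,
  \<open>tleft B P M N : P \<triangleleft> (M \<odot> N) \<rightarrow> (P \<triangleleft> M) \<triangleleft> N\<close>,
  \<open>ca B N P M : (N \<triangleright> P) \<triangleleft> M \<rightarrow> N \<triangleright> (P \<triangleleft> M)\<close>,
  \<open>lbar B M : M \<rightarrow> M \<triangleleft> U R\<close> and \<open>rbar B M : M \<rightarrow> U S \<triangleright> M\<close> for \<open>M : R \<rightarrow> S\<close>,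
  with the associators needed for transposing made explicit.
\<close>

definition tright :: "('o, 'm, 'c, 'z) closed_bicat_scheme \<Rightarrow> 'm \<Rightarrow> 'm \<Rightarrow> 'm \<Rightarrow> 'c" where
  "tright B M N P =
    (let X = (M \<odot>\<^bsub>B\<^esub> N) \<triangleright>\<^bsub>B\<^esub> P
     in curryr B X M (N \<triangleright>\<^bsub>B\<^esub> P)
          (curryr B (X \<odot>\<^bsub>B\<^esub> M) N P (evr B (M \<odot>\<^bsub>B\<^esub> N) P \<cdot>\<^bsub>B\<^esub> assoc B X M N)))"

definition tleft :: "('o, 'm, 'c, 'z) closed_bicat_scheme \<Rightarrow> 'm \<Rightarrow> 'm \<Rightarrow> 'm \<Rightarrow> 'c" where
  "tleft B P M N =
    (let Y = P \<triangleleft>\<^bsub>B\<^esub> (M \<odot>\<^bsub>B\<^esub> N)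
     in curryl B N Y (P \<triangleleft>\<^bsub>B\<^esub> M)
          (curryl B M (N \<odot>\<^bsub>B\<^esub> Y) P (evl B (M \<odot>\<^bsub>B\<^esub> N) P \<cdot>\<^bsub>B\<^esub> Inv B (assoc B M N Y))))"

definition ca :: "('o, 'm, 'c, 'z) closed_bicat_scheme \<Rightarrow> 'm \<Rightarrow> 'm \<Rightarrow> 'm \<Rightarrow> 'c" where
  "ca B N P M =
    (let Z = (N \<triangleright>\<^bsub>B\<^esub> P) \<triangleleft>\<^bsub>B\<^esub> M
     in curryr B Z N (P \<triangleleft>\<^bsub>B\<^esub> M)
          (curryl B M (Z \<odot>\<^bsub>B\<^esub> N) P
            (evr B N P \<cdot>\<^bsub>B\<^esub> (evl B M (N \<triangleright>\<^bsub>B\<^esub> P) \<otimes>\<^bsub>B\<^esub> \<one>\<^bsub>B\<^esub> N) \<cdot>\<^bsub>B\<^esub> Inv B (assoc B M Z N))))"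

definition lbar :: "('o, 'm, 'c, 'z) closed_bicat_scheme \<Rightarrow> 'm \<Rightarrow> 'c" where
  "lbar B M = curryl B (U\<^bsub>B\<^esub> (src B M)) M M (lunit B M)"

definition rbar :: "('o, 'm, 'c, 'z) closed_bicat_scheme \<Rightarrow> 'm \<Rightarrow> 'c" where
  "rbar B M = curryr B M (U\<^bsub>B\<^esub> (trg B M)) M (runit B M)"


section \<open>Duality and Morita equivalence\<close>

text \<open>The triangle identities, with unitors and associators made explicit.\<close>

definition triangle_identities ::
  "('o, 'm, 'c, 'z) bicat_scheme \<Rightarrow> 'm \<Rightarrow> 'm \<Rightarrow> 'c \<Rightarrow> 'c \<Rightarrow> bool" where
  "triangle_identities B M M' \<eta> \<epsilon> \<longleftrightarrow>
     runit B M \<cdot>\<^bsub>B\<^esub> (\<one>\<^bsub>B\<^esub> M \<otimes>\<^bsub>B\<^esub> \<epsilon>) \<cdot>\<^bsub>B\<^esub> assoc B M M' M \<cdot>\<^bsub>B\<^esub> (\<eta> \<otimes>\<^bsub>B\<^esub> \<one>\<^bsub>B\<^esub> M)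
       \<cdot>\<^bsub>B\<^esub> Inv B (lunit B M) = \<one>\<^bsub>B\<^esub> M \<and>
     lunit B M' \<cdot>\<^bsub>B\<^esub> (\<epsilon> \<otimes>\<^bsub>B\<^esub> \<one>\<^bsub>B\<^esub> M') \<cdot>\<^bsub>B\<^esub> Inv B (assoc B M' M M') \<cdot>\<^bsub>B\<^esub> (\<one>\<^bsub>B\<^esub> M' \<otimes>\<^bsub>B\<^esub> \<eta>)
       \<cdot>\<^bsub>B\<^esub> Inv B (runit B M') = \<one>\<^bsub>B\<^esub> M'"

definition dual_pair ::
  "('o, 'm, 'c, 'z) bicat_scheme \<Rightarrow> 'o \<Rightarrow> 'o \<Rightarrow> 'm \<Rightarrow> 'm \<Rightarrow> 'c \<Rightarrow> 'c \<Rightarrow> bool" where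
  "dual_pair B R S M M' \<eta> \<epsilon> \<longleftrightarrow>
     M \<in> Cell B R S \<and> M' \<in> Cell B S R \<and>
     \<eta> \<in> Hom B (U\<^bsub>B\<^esub> R) (M \<odot>\<^bsub>B\<^esub> M') \<and> \<epsilon> \<in> Hom B (M' \<odot>\<^bsub>B\<^esub> M) (U\<^bsub>B\<^esub> S) \<and>
     triangle_identities B M M' \<eta> \<epsilon>"

definition right_dualizable :: "('o, 'm, 'c, 'z) bicat_scheme \<Rightarrow> 'o \<Rightarrow> 'o \<Rightarrow> 'm \<Rightarrow> bool" where
  "right_dualizable B R S M \<longleftrightarrow> (\<exists>M' \<eta> \<epsilon>. dual_pair B R S M M' \<eta> \<epsilon>)"

definition morita_equivalence ::
  "('o, 'm, 'c, 'z) bicat_scheme \<Rightarrow> 'o \<Rightarrow> 'o \<Rightarrow> 'm \<Rightarrow> 'm \<Rightarrow> 'c \<Rightarrow> 'c \<Rightarrow> bool" where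
  "morita_equivalence B R S P Q \<eta> \<epsilon> \<longleftrightarrow>
     P \<in> Cell B R S \<and> Q \<in> Cell B S R \<and>
     \<eta> \<in> Iso B (U\<^bsub>B\<^esub> R) (P \<odot>\<^bsub>B\<^esub> Q) \<and> \<epsilon> \<in> Iso B (Q \<odot>\<^bsub>B\<^esub> P) (U\<^bsub>B\<^esub> S) \<and>
     triangle_identities B P Q \<eta> \<epsilon>"


section \<open>Coshadows and cotraces\<close>

text \<open>
  As the hom-categories \<open>\<B>(R,R)\<close> are disjoint, the family of functors \<open>Csh : \<B>(R,R) \<rightarrow> T\<close>
  is given by one map on 1-cells and one map on 2-cells, constrained on endo-1-cells only.
  \<open>theta K M N\<close> is the isomorphism \<open>Csh (M \<triangleright> N) \<rightarrow> Csh (N \<triangleleft> M)\<close>.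
\<close>

record ('m, 'c, 't, 'u) coshadow_data =
  Csh1 :: "'m \<Rightarrow> 't"
  Csh2 :: "'c \<Rightarrow> 'u"
  theta :: "'m \<Rightarrow> 'm \<Rightarrow> 'u"

locale coshadow = closed_bicategory B + T: category T
  for B :: "('o, 'm, 'c, 'z) closed_bicat_scheme" (structure)
    and T :: "('t, 'u, 'y) cat_scheme"
    and K :: "('m, 'c, 't, 'u, 'x) coshadow_data_scheme" +
  assumes Csh1_ob: "M \<in> Cell B R R \<Longrightarrow> Csh1 K M \<in> Ob T"
    and Csh2_hom: "\<lbrakk>M \<in> Cell B R R; \<alpha> \<in> Hom B M N\<rbrakk> \<Longrightarrow> Csh2 K \<alpha> \<in> Hom T (Csh1 K M) (Csh1 K N)"
    and Csh2_idt: "M \<in> Cell B R R \<Longrightarrow> Csh2 K (\<one> M) = \<one>\<^bsub>T\<^esub> (Csh1 K M)"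
    and Csh2_cmp: "\<lbrakk>L \<in> Cell B R R; \<alpha> \<in> Hom B L M; \<beta> \<in> Hom B M N\<rbrakk>
      \<Longrightarrow> Csh2 K (\<beta> \<cdot> \<alpha>) = Csh2 K \<beta> \<cdot>\<^bsub>T\<^esub> Csh2 K \<alpha>"
    and theta_iso: "\<lbrakk>M \<in> Cell B R S; N \<in> Cell B R S\<rbrakk>
      \<Longrightarrow> theta K M N \<in> Iso T (Csh1 K (M \<triangleright> N)) (Csh1 K (N \<triangleleft> M))"
    and theta_natural: "\<lbrakk>M \<in> Cell B R S; N \<in> Cell B R S; \<mu> \<in> Hom B M' M; \<nu> \<in> Hom B N N'\<rbrakk>
      \<Longrightarrow> theta K M' N' \<cdot>\<^bsub>T\<^esub> Csh2 K (\<mu> \<rhd> \<nu>) = Csh2 K (\<nu> \<lhd> \<mu>) \<cdot>\<^bsub>T\<^esub> theta K M N"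
    and theta_hcmp: "\<lbrakk>M \<in> Cell B R S; N \<in> Cell B S V; P \<in> Cell B R V\<rbrakk>
      \<Longrightarrow> Inv T (theta K N (P \<triangleleft> M)) \<cdot>\<^bsub>T\<^esub> Csh2 K (tleft B P M N) \<cdot>\<^bsub>T\<^esub> theta K (M \<odot> N) P
        = Csh2 K (ca B N P M) \<cdot>\<^bsub>T\<^esub> theta K M (N \<triangleright> P) \<cdot>\<^bsub>T\<^esub> Csh2 K (tright B M N P)"
    and theta_unit: "M \<in> Cell B R R
      \<Longrightarrow> Csh2 K (Inv B (lbar B M)) \<cdot>\<^bsub>T\<^esub> theta K (U R) M = Csh2 K (Inv B (rbar B M))"

text \<open>
  The cotrace \<open>Csh Q \<rightarrow> Csh P\<close> of \<open>f : M \<triangleright> Q \<rightarrow> P \<triangleleft> M\<close> with respect to the dual pair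
  \<open>(M, M')\<close>, where \<open>M : R \<rightarrow> S\<close>, \<open>Q : S \<rightarrow> S\<close> and \<open>P : R \<rightarrow> R\<close>.
\<close>

definition cotrace ::
  "('o, 'm, 'c, 'z) closed_bicat_scheme \<Rightarrow> ('t, 'u, 'y) cat_scheme
    \<Rightarrow> ('m, 'c, 't, 'u, 'x) coshadow_data_scheme
    \<Rightarrow> 'm \<Rightarrow> 'm \<Rightarrow> 'c \<Rightarrow> 'c \<Rightarrow> 'm \<Rightarrow> 'm \<Rightarrow> 'c \<Rightarrow> 'u" where
  "cotrace B T K M M' \<eta> \<epsilon> Q P f =
     Csh2 K (Inv B (lbar B P) \<cdot>\<^bsub>B\<^esub> (\<one>\<^bsub>B\<^esub> P \<lhd>\<^bsub>B\<^esub> \<eta>) \<cdot>\<^bsub>B\<^esub> Inv B (tleft B P M M'))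
     \<cdot>\<^bsub>T\<^esub> theta K M' (P \<triangleleft>\<^bsub>B\<^esub> M)
     \<cdot>\<^bsub>T\<^esub> Csh2 K ((\<one>\<^bsub>B\<^esub> M' \<rhd>\<^bsub>B\<^esub> f) \<cdot>\<^bsub>B\<^esub> tright B M' M Q \<cdot>\<^bsub>B\<^esub> (\<epsilon> \<rhd>\<^bsub>B\<^esub> \<one>\<^bsub>B\<^esub> Q) \<cdot>\<^bsub>B\<^esub> rbar B Q)"

end

theory Submission
  imports Defs
begin

text \<open>
  In the cotrace along \<open>(N, N')\<close> every factor other than \<open>f\<close> is an isomorphism, except possibly
  those induced by the unit and counit of the dual pair.  When these are invertible too, as they
  are in a Morita equivalence, the cotrace of any isomorphism \<open>f\<close> is therefore an isomorphism
  (\<open>cotrace_iso\<close>).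

  Reversing the given equivalence and inverting its unit and counit gives a dual pair \<open>(Q, P)\<close>
  (\<open>dual_pair_reverse\<close>), so \<open>N = Q\<close> is right dualizable, and only an isomorphism
  \<open>f : Q \<triangleright> M \<rightarrow> (Q \<odot> M \<odot> P) \<triangleleft> Q\<close> is wanted.  Both sides are isomorphic to \<open>M \<odot> P\<close>: tensoring with the
  invertible 1-cell \<open>Q\<close> is fully faithful on either side (\<open>left_tensor_bij\<close>, \<open>right_tensor_bij\<close>),
  so 2-cells \<open>Z \<rightarrow> M \<odot> P\<close> correspond to 2-cells \<open>Z \<odot> Q \<rightarrow> M \<odot> P \<odot> Q \<cong> M\<close>, and also to 2-cells
  \<open>Q \<odot> Z \<rightarrow> Q \<odot> M \<odot> P\<close>; these are the universal properties of the two hom-objects.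

  All isomorphisms with hom-objects, including the canonical ones \<open>t\<close>, \<open>lbar\<close> and \<open>rbar\<close>, come
  from one form of the Yoneda lemma (\<open>curryl_iso\<close>, \<open>curryr_iso\<close>): the transpose of
  \<open>\<phi> : M \<odot> N \<rightarrow> P\<close> is invertible as soon as every 2-cell \<open>M \<odot> Z \<rightarrow> P\<close> factors uniquely through
  \<open>\<phi>\<close> as \<open>\<phi> \<cdot> (1 \<otimes> h)\<close>.
\<close>

section \<open>Isomorphisms in a category\<close>

context category
begin

lemma iso_hom: "f \<in> Iso C X Y \<Longrightarrow> f \<in> Hom C X Y"
  by (simp add: Iso_def)

lemma hom_ob: "f \<in> Hom C X Y \<Longrightarrow> X \<in> Ob C \<and> Y \<in> Ob C"
  using dom_ob cod_ob by (auto simp: Hom_def)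

lemma Inv_eq:
  assumes f: "f \<in> Hom C X Y" and g: "g \<in> Hom C Y X" and gf: "g \<cdot> f = \<one> X" and fg: "f \<cdot> g = \<one> Y"
  shows "Inv C f = g"
proof -
  have dc: "Dom C f = X" "Cod C f = Y" using f by (auto simp: Hom_def)
  have "g' = g" if "g' \<in> Hom C Y X" "g' \<cdot> f = \<one> X" "f \<cdot> g' = \<one> Y" for g'
  proof -
    have "g' = (g' \<cdot> f) \<cdot> g"
      using cmp_assoc[OF g f that(1)] fg cmp_idt_right[OF that(1)] by simp
    also have "\<dots> = g" using that(2) cmp_idt_left[OF g] by simp
    finally show ?thesis .
  qed
  then show ?thesis unfolding Inv_def dc by (intro the_equality conjI g gf fg) blast
qed

lemma isoI:
  "\<lbrakk>f \<in> Hom C X Y; g \<in> Hom C Y X; g \<cdot> f = \<one> X; f \<cdot> g = \<one> Y\<rbrakk> \<Longrightarrow> f \<in> Iso C X Y"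
  by (auto simp: Iso_def)

lemma
  assumes "f \<in> Iso C X Y"
  shows Inv_hom: "Inv C f \<in> Hom C Y X"
    and Inv_left: "Inv C f \<cdot> f = \<one> X"
    and Inv_right: "f \<cdot> Inv C f = \<one> Y"
proof -
  obtain g where g: "g \<in> Hom C Y X" "g \<cdot> f = \<one> X" "f \<cdot> g = \<one> Y" and f: "f \<in> Hom C X Y"
    using assms by (auto simp: Iso_def)
  have "Inv C f = g" using Inv_eq f g by blast
  then show "Inv C f \<in> Hom C Y X" "Inv C f \<cdot> f = \<one> X" "f \<cdot> Inv C f = \<one> Y" using g by auto
qed

lemma Inv_iso: "f \<in> Iso C X Y \<Longrightarrow> Inv C f \<in> Iso C Y X"
  using isoI iso_hom Inv_hom Inv_left Inv_right by blast

lemma Inv_Inv: "f \<in> Iso C X Y \<Longrightarrow> Inv C (Inv C f) = f"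
  using Inv_eq iso_hom Inv_hom Inv_left Inv_right by blast

lemma idt_iso: "X \<in> Ob C \<Longrightarrow> \<one> X \<in> Iso C X X"
  using isoI idt_hom cmp_idt_left by metis

lemma Inv_idt: "X \<in> Ob C \<Longrightarrow> Inv C (\<one> X) = \<one> X"
  using Inv_eq idt_hom cmp_idt_left by metis

lemma
  assumes f: "f \<in> Iso C X Y" and g: "g \<in> Iso C Y Z"
  shows iso_cmp: "g \<cdot> f \<in> Iso C X Z"
    and Inv_cmp: "Inv C (g \<cdot> f) = Inv C f \<cdot> Inv C g"
proof -
  note fh = iso_hom[OF f] and gh = iso_hom[OF g] and fi = Inv_hom[OF f] and gi = Inv_hom[OF g]
  have h: "g \<cdot> f \<in> Hom C X Z" and i: "Inv C f \<cdot> Inv C g \<in> Hom C Z X"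
    using cmp_hom fh gh fi gi by blast+
  have "(Inv C f \<cdot> Inv C g) \<cdot> (g \<cdot> f) = Inv C f \<cdot> ((Inv C g \<cdot> g) \<cdot> f)"
    using cmp_assoc[OF h gi fi] cmp_assoc[OF fh gh gi] by simp
  then have 1: "(Inv C f \<cdot> Inv C g) \<cdot> (g \<cdot> f) = \<one> X"
    using Inv_left[OF f] Inv_left[OF g] cmp_idt_left[OF fh] by simp
  have "(g \<cdot> f) \<cdot> (Inv C f \<cdot> Inv C g) = g \<cdot> ((f \<cdot> Inv C f) \<cdot> Inv C g)"
    using cmp_assoc[OF i fh gh] cmp_assoc[OF gi fi fh] by simp
  then have 2: "(g \<cdot> f) \<cdot> (Inv C f \<cdot> Inv C g) = \<one> Z"
    using Inv_right[OF f] Inv_right[OF g] cmp_idt_left[OF gi] by simp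
  show "g \<cdot> f \<in> Iso C X Z" "Inv C (g \<cdot> f) = Inv C f \<cdot> Inv C g"
    using isoI[OF h i 1 2] Inv_eq[OF h i 1 2] .
qed

text \<open>
  Each triangle identity says that a composite of five arrows is an identity; inverting it term
  by term produces a triangle identity for the reversed pair.
\<close>

lemma Inv_cmp5:
  assumes f1: "f1 \<in> Iso C V W" and f2: "f2 \<in> Iso C W X" and f3: "f3 \<in> Iso C X Y"
    and f4: "f4 \<in> Iso C Y Z" and f5: "f5 \<in> Iso C Z A"
  shows "Inv C (f5 \<cdot> f4 \<cdot> f3 \<cdot> f2 \<cdot> f1) = Inv C f1 \<cdot> Inv C f2 \<cdot> Inv C f3 \<cdot> Inv C f4 \<cdot> Inv C f5"
proof -
  note i1 = Inv_hom[OF f1] and i2 = Inv_hom[OF f2] and i3 = Inv_hom[OF f3]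
    and i4 = Inv_hom[OF f4] and i5 = Inv_hom[OF f5]
  note f54 = iso_cmp[OF f4 f5] note f543 = iso_cmp[OF f3 f54] note f5432 = iso_cmp[OF f2 f543]
  note i12 = cmp_hom[OF i2 i1] note i123 = cmp_hom[OF i3 i12]
  show ?thesis
    using Inv_cmp[OF f1 f5432] Inv_cmp[OF f2 f543] Inv_cmp[OF f3 f54] Inv_cmp[OF f4 f5]
      cmp_assoc[OF Inv_hom[OF f543] i2 i1] cmp_assoc[OF Inv_hom[OF f54] i3 i12]
      cmp_assoc[OF i5 i4 i123] by simp
qed

lemma iso_post_bij:
  assumes f: "f \<in> Iso C X Y"
  shows "bij_betw (\<lambda>h. f \<cdot> h) (Hom C Z X) (Hom C Z Y)"
proof (rule bij_betw_byWitness[where f' = "\<lambda>h. Inv C f \<cdot> h"])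
  show "(\<lambda>h. f \<cdot> h) ` Hom C Z X \<subseteq> Hom C Z Y" using cmp_hom iso_hom[OF f] by blast
  show "(\<lambda>h. Inv C f \<cdot> h) ` Hom C Z Y \<subseteq> Hom C Z X" using cmp_hom Inv_hom[OF f] by blast
  have "Inv C f \<cdot> (f \<cdot> h) = h" if "h \<in> Hom C Z X" for h
    using cmp_assoc[OF that iso_hom[OF f] Inv_hom[OF f]] Inv_left[OF f] cmp_idt_left[OF that] by simp
  then show "\<forall>h \<in> Hom C Z X. Inv C f \<cdot> (f \<cdot> h) = h" by blast
  have "f \<cdot> (Inv C f \<cdot> h) = h" if "h \<in> Hom C Z Y" for h
    using cmp_assoc[OF that Inv_hom[OF f] iso_hom[OF f]] Inv_right[OF f] cmp_idt_left[OF that] by simp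
  then show "\<forall>h \<in> Hom C Z Y. f \<cdot> (Inv C f \<cdot> h) = h" by blast
qed

lemma iso_pre_bij:
  assumes f: "f \<in> Iso C X Y"
  shows "bij_betw (\<lambda>h. h \<cdot> f) (Hom C Y Z) (Hom C X Z)"
proof (rule bij_betw_byWitness[where f' = "\<lambda>h. h \<cdot> Inv C f"])
  show "(\<lambda>h. h \<cdot> f) ` Hom C Y Z \<subseteq> Hom C X Z" using cmp_hom iso_hom[OF f] by blast
  show "(\<lambda>h. h \<cdot> Inv C f) ` Hom C X Z \<subseteq> Hom C Y Z" using cmp_hom Inv_hom[OF f] by blast
  have "(h \<cdot> f) \<cdot> Inv C f = h" if "h \<in> Hom C Y Z" for h
    using cmp_assoc[OF Inv_hom[OF f] iso_hom[OF f] that] Inv_right[OF f] cmp_idt_right[OF that] by simp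
  then show "\<forall>h \<in> Hom C Y Z. (h \<cdot> f) \<cdot> Inv C f = h" by blast
  have "(h \<cdot> Inv C f) \<cdot> f = h" if "h \<in> Hom C X Z" for h
    using cmp_assoc[OF iso_hom[OF f] Inv_hom[OF f] that] Inv_left[OF f] cmp_idt_right[OF that] by simp
  then show "\<forall>h \<in> Hom C X Z. (h \<cdot> Inv C f) \<cdot> f = h" by blast
qed

text \<open>
  Surjectivity at \<open>Y\<close> gives a right inverse of \<open>f\<close>, and injectivity at \<open>X\<close> makes it a left
  inverse.
\<close>

lemma iso_if_post_bij:
  assumes f: "f \<in> Hom C X Y"
    and bX: "bij_betw (\<lambda>h. f \<cdot> h) (Hom C X X) (Hom C X Y)"
    and bY: "bij_betw (\<lambda>h. f \<cdot> h) (Hom C Y X) (Hom C Y Y)"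
  shows "f \<in> Iso C X Y"
proof -
  have X: "X \<in> Ob C" and Y: "Y \<in> Ob C" using hom_ob[OF f] by auto
  obtain g where g: "g \<in> Hom C Y X" and fg: "f \<cdot> g = \<one> Y"
    using bij_betw_imp_surj_on[OF bY] idt_hom[OF Y] by (metis imageE)
  have "f \<cdot> (g \<cdot> f) = f \<cdot> \<one> X"
    using cmp_assoc[OF f g f] fg cmp_idt_left[OF f] cmp_idt_right[OF f] by simp
  then have "g \<cdot> f = \<one> X"
    using inj_onD[OF bij_betw_imp_inj_on[OF bX]] cmp_hom[OF f g] idt_hom[OF X] by blast
  then show ?thesis using isoI f g fg by blast
qed

lemma natural_inverse:
  assumes k: "k \<in> Iso C X X'" and l: "l \<in> Iso C Y Y'" and f: "f \<in> Hom C X Y" and g: "g \<in> Hom C X' Y'"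
    and nat: "l \<cdot> f = g \<cdot> k"
  shows "Inv C l \<cdot> g = f \<cdot> Inv C k"
proof -
  note kh = iso_hom[OF k] and ki = Inv_hom[OF k] and lh = iso_hom[OF l] and li = Inv_hom[OF l]
  have "Inv C l \<cdot> g = Inv C l \<cdot> ((g \<cdot> k) \<cdot> Inv C k)"
    using cmp_assoc[OF ki kh g] Inv_right[OF k] cmp_idt_right[OF g] by simp
  also have "\<dots> = Inv C l \<cdot> (l \<cdot> (f \<cdot> Inv C k))"
    using nat cmp_assoc[OF ki f lh] by simp
  also have "\<dots> = f \<cdot> Inv C k"
    using cmp_assoc[OF cmp_hom[OF ki f] lh li] Inv_left[OF l] cmp_idt_left[OF cmp_hom[OF ki f]] by simp
  finally show ?thesis .
qed

text \<open>
  If \<open>F\<close> is naturally isomorphic to the identity functor, it is \<open>f \<mapsto> l \<cdot> f \<cdot> k\<^sup>-\<^sup>1\<close> on hom-sets.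
\<close>

lemma conjugation_bij:
  assumes k: "k \<in> Iso C X X'" and l: "l \<in> Iso C Y Y'"
    and F: "\<And>f. f \<in> Hom C X Y \<Longrightarrow> F f \<in> Hom C X' Y'"
    and nat: "\<And>f. f \<in> Hom C X Y \<Longrightarrow> l \<cdot> f = F f \<cdot> k"
  shows "bij_betw F (Hom C X Y) (Hom C X' Y')"
proof -
  have "bij_betw ((\<lambda>h. h \<cdot> Inv C k) \<circ> (\<lambda>h. l \<cdot> h)) (Hom C X Y) (Hom C X' Y')"
    using bij_betw_trans iso_post_bij[OF l] iso_pre_bij[OF Inv_iso[OF k]] by blast
  moreover have "((\<lambda>h. h \<cdot> Inv C k) \<circ> (\<lambda>h. l \<cdot> h)) f = F f" if "f \<in> Hom C X Y" for f
    using nat[OF that] cmp_assoc[OF Inv_hom[OF k] iso_hom[OF k] F[OF that]]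
      Inv_right[OF k] cmp_idt_right[OF F[OF that]] by simp
  ultimately show ?thesis by (simp cong: bij_betw_cong)
qed

end

text \<open>
  The reason why an equivalence of categories is fully faithful, with \<open>F\<close>, \<open>G\<close>, \<open>H\<close> the actions on
  successive hom-sets: injectivity of \<open>G\<close> cancels \<open>G\<close> from the surjectivity of \<open>G \<circ> F\<close>.
\<close>

lemma bij_betw_if_composites:
  assumes FA: "F ` A \<subseteq> B" and GB: "G ` B \<subseteq> C"
    and GF: "bij_betw (G \<circ> F) A C" and HG: "inj_on (H \<circ> G) B"
  shows "bij_betw F A B"
proof (rule bij_betw_imageI)
  show "inj_on F A" using bij_betw_imp_inj_on[OF GF] by (rule inj_on_imageI2)
  have G: "inj_on G B" using HG by (rule inj_on_imageI2)
  have "b \<in> F ` A" if "b \<in> B" for b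
  proof -
    have "G b \<in> (G \<circ> F) ` A" using bij_betw_imp_surj_on[OF GF] GB that by blast
    then obtain x where "x \<in> A" "G (F x) = G b" by auto
    then show ?thesis using inj_onD[OF G] FA that by blast
  qed
  then show "F ` A = B" using FA by blast
qed

section \<open>Tensoring with an invertible 1-cell\<close>

context bicategory
begin

lemma cell_ob: "M \<in> Cell B R S \<Longrightarrow> M \<in> Ob B"
  by (simp add: Cell_def)

lemma cell_obj: "M \<in> Cell B R S \<Longrightarrow> R \<in> Obj B \<and> S \<in> Obj B"
  using src_obj trg_obj by (auto simp: Cell_def)

lemma cell_hom: "\<lbrakk>M \<in> Cell B R S; \<alpha> \<in> Hom B M N\<rbrakk> \<Longrightarrow> N \<in> Cell B R S"
  using parallel[of \<alpha> M N] hom_ob[of \<alpha> M N] by (auto simp: Cell_def)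

lemma idt_cell: "M \<in> Cell B R S \<Longrightarrow> \<one> M \<in> Iso B M M"
  using cell_ob idt_iso by blast

lemma
  assumes M: "M \<in> Cell B R S" and N: "N \<in> Cell B S T"
    and a: "\<alpha> \<in> Iso B M M'" and b: "\<beta> \<in> Iso B N N'"
  shows hcmp2_iso: "\<alpha> \<otimes> \<beta> \<in> Iso B (M \<odot> N) (M' \<odot> N')"
    and hcmp2_Inv: "Inv B (\<alpha> \<otimes> \<beta>) = Inv B \<alpha> \<otimes> Inv B \<beta>"
proof -
  note ah = iso_hom[OF a] and ai = Inv_hom[OF a] and bh = iso_hom[OF b] and bi = Inv_hom[OF b]
  have M': "M' \<in> Cell B R S" and N': "N' \<in> Cell B S T" using cell_hom M N ah bh by blast+
  note h = hcmp2_hom[OF M N ah bh] and i = hcmp2_hom[OF M' N' ai bi]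
  have 1: "(Inv B \<alpha> \<otimes> Inv B \<beta>) \<cdot> (\<alpha> \<otimes> \<beta>) = \<one> (M \<odot> N)"
    using hcmp2_cmp[OF M N ah ai bh bi] Inv_left[OF a] Inv_left[OF b] hcmp2_idt[OF M N] by simp
  have 2: "(\<alpha> \<otimes> \<beta>) \<cdot> (Inv B \<alpha> \<otimes> Inv B \<beta>) = \<one> (M' \<odot> N')"
    using hcmp2_cmp[OF M' N' ai ah bi bh] Inv_right[OF a] Inv_right[OF b] hcmp2_idt[OF M' N'] by simp
  show "\<alpha> \<otimes> \<beta> \<in> Iso B (M \<odot> N) (M' \<odot> N')" "Inv B (\<alpha> \<otimes> \<beta>) = Inv B \<alpha> \<otimes> Inv B \<beta>"
    using isoI[OF h i 1 2] Inv_eq[OF h i 1 2] .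
qed

lemma hcmp2_interchange:
  assumes "M \<in> Cell B R S" "N \<in> Cell B S T" "\<alpha> \<in> Hom B M M'" "\<beta> \<in> Hom B N N'"
  shows "(\<alpha> \<otimes> \<one> N') \<cdot> (\<one> M \<otimes> \<beta>) = (\<one> M' \<otimes> \<beta>) \<cdot> (\<alpha> \<otimes> \<one> N)"
proof -
  have M: "\<one> M \<in> Hom B M M" "\<one> M' \<in> Hom B M' M'" and N: "\<one> N \<in> Hom B N N" "\<one> N' \<in> Hom B N' N'"
    using idt_hom hom_ob assms(3,4) by blast+
  show ?thesis
    using hcmp2_cmp[OF assms(1,2) M(1) assms(3,4) N(2)] hcmp2_cmp[OF assms(1,2,3) M(2) N(1) assms(4)]
      cmp_idt_left[OF assms(3)] cmp_idt_right[OF assms(3)]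
      cmp_idt_left[OF assms(4)] cmp_idt_right[OF assms(4)] by simp
qed

text \<open>
  The 2-cells \<open>k Z : Z \<cong> U \<odot> Z \<cong> (P \<odot> Q) \<odot> Z \<cong> P \<odot> (Q \<odot> Z)\<close> form a natural isomorphism from the
  identity to the composite of the two tensoring functors.
\<close>

lemma left_tensor_composite_bij:
  assumes P: "P \<in> Cell B R S" and Q: "Q \<in> Cell B S R" and e: "e \<in> Iso B (U R) (P \<odot> Q)"
    and X: "X \<in> Cell B R T" and Y: "Y \<in> Cell B R T"
  shows "bij_betw (\<lambda>h. \<one> P \<otimes> (\<one> Q \<otimes> h)) (Hom B X Y) (Hom B (P \<odot> (Q \<odot> X)) (P \<odot> (Q \<odot> Y)))"
proof -
  define k where "k Z = assoc B P Q Z \<cdot> ((e \<otimes> \<one> Z) \<cdot> Inv B (lunit B Z))" for Z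
  have U: "U R \<in> Cell B R R" using unit_cell cell_obj[OF P] by blast
  have PQ: "P \<odot> Q \<in> Cell B R R" using hcmp1_cell P Q by blast
  have P1: "\<one> P \<in> Hom B P P" and Q1: "\<one> Q \<in> Hom B Q Q" using idt_hom cell_ob P Q by blast+
  have k1: "(e \<otimes> \<one> Z) \<cdot> Inv B (lunit B Z) \<in> Iso B Z ((P \<odot> Q) \<odot> Z)" if "Z \<in> Cell B R T" for Z
    using iso_cmp[OF Inv_iso[OF lunit_iso[OF that]] hcmp2_iso[OF U that e idt_cell[OF that]]] .
  have k: "k Z \<in> Iso B Z (P \<odot> (Q \<odot> Z))" if "Z \<in> Cell B R T" for Z
    unfolding k_def using iso_cmp[OF k1[OF that] assoc_iso[OF P Q that]] .
  have Fh: "\<one> P \<otimes> (\<one> Q \<otimes> h) \<in> Hom B (P \<odot> (Q \<odot> X)) (P \<odot> (Q \<odot> Y))" if h: "h \<in> Hom B X Y" for h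
    using hcmp2_hom[OF P hcmp1_cell[OF Q X] P1 hcmp2_hom[OF Q X Q1 h]] .
  have "k Y \<cdot> h = (\<one> P \<otimes> (\<one> Q \<otimes> h)) \<cdot> k X" if h: "h \<in> Hom B X Y" for h
  proof -
    have Uh: "\<one> (U R) \<otimes> h \<in> Hom B (U R \<odot> X) (U R \<odot> Y)"
      using hcmp2_hom[OF U X] idt_hom cell_ob U h by blast
    have lX: "Inv B (lunit B X) \<in> Hom B X (U R \<odot> X)" and lY: "Inv B (lunit B Y) \<in> Hom B Y (U R \<odot> Y)"
      using Inv_hom lunit_iso X Y by blast+
    have eX: "e \<otimes> \<one> X \<in> Hom B (U R \<odot> X) ((P \<odot> Q) \<odot> X)" and eY: "e \<otimes> \<one> Y \<in> Hom B (U R \<odot> Y) ((P \<odot> Q) \<odot> Y)"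
      using hcmp2_iso[OF U X e idt_cell[OF X]] hcmp2_iso[OF U Y e idt_cell[OF Y]] iso_hom by blast+
    have aX: "assoc B P Q X \<in> Hom B ((P \<odot> Q) \<odot> X) (P \<odot> (Q \<odot> X))"
      and aY: "assoc B P Q Y \<in> Hom B ((P \<odot> Q) \<odot> Y) (P \<odot> (Q \<odot> Y))"
      using assoc_iso P Q X Y iso_hom by blast+
    have PQh: "\<one> (P \<odot> Q) \<otimes> h \<in> Hom B ((P \<odot> Q) \<odot> X) ((P \<odot> Q) \<odot> Y)"
      using hcmp2_hom[OF PQ X] idt_hom cell_ob PQ h by blast
    have "((e \<otimes> \<one> Y) \<cdot> Inv B (lunit B Y)) \<cdot> h = (e \<otimes> \<one> Y) \<cdot> (Inv B (lunit B Y) \<cdot> h)"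
      using cmp_assoc[OF h lY eY] .
    also have "\<dots> = (e \<otimes> \<one> Y) \<cdot> ((\<one> (U R) \<otimes> h) \<cdot> Inv B (lunit B X))"
      using natural_inverse[OF lunit_iso[OF X] lunit_iso[OF Y] Uh h lunit_natural[OF X h]] by simp
    also have "\<dots> = ((\<one> (P \<odot> Q) \<otimes> h) \<cdot> (e \<otimes> \<one> X)) \<cdot> Inv B (lunit B X)"
      using cmp_assoc[OF lX Uh eY] hcmp2_interchange[OF U X iso_hom[OF e] h] by simp
    also have "\<dots> = (\<one> (P \<odot> Q) \<otimes> h) \<cdot> ((e \<otimes> \<one> X) \<cdot> Inv B (lunit B X))"
      using cmp_assoc[OF lX eX PQh] .
    finally have 1: "((e \<otimes> \<one> Y) \<cdot> Inv B (lunit B Y)) \<cdot> h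
      = (\<one> (P \<odot> Q) \<otimes> h) \<cdot> ((e \<otimes> \<one> X) \<cdot> Inv B (lunit B X))" .
    have "k Y \<cdot> h = assoc B P Q Y \<cdot> (((e \<otimes> \<one> Y) \<cdot> Inv B (lunit B Y)) \<cdot> h)"
      unfolding k_def using cmp_assoc[OF h cmp_hom[OF lY eY] aY] .
    also have "\<dots> = (assoc B P Q Y \<cdot> (\<one> (P \<odot> Q) \<otimes> h)) \<cdot> ((e \<otimes> \<one> X) \<cdot> Inv B (lunit B X))"
      using 1 cmp_assoc[OF cmp_hom[OF lX eX] PQh aY] by simp
    also have "\<dots> = ((\<one> P \<otimes> (\<one> Q \<otimes> h)) \<cdot> assoc B P Q X) \<cdot> ((e \<otimes> \<one> X) \<cdot> Inv B (lunit B X))"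
      using assoc_natural[OF P Q X P1 Q1 h] hcmp2_idt[OF P Q] by simp
    also have "\<dots> = (\<one> P \<otimes> (\<one> Q \<otimes> h)) \<cdot> k X"
      unfolding k_def using cmp_assoc[OF cmp_hom[OF lX eX] aX Fh[OF h]] .
    finally show ?thesis .
  qed
  then show ?thesis using Fh by (rule conjugation_bij[OF k[OF X] k[OF Y], rotated])
qed

lemma right_tensor_composite_bij:
  assumes P: "P \<in> Cell B R S" and Q: "Q \<in> Cell B S R" and e: "e \<in> Iso B (U R) (P \<odot> Q)"
    and X: "X \<in> Cell B T R" and Y: "Y \<in> Cell B T R"
  shows "bij_betw (\<lambda>h. (h \<otimes> \<one> P) \<otimes> \<one> Q) (Hom B X Y) (Hom B ((X \<odot> P) \<odot> Q) ((Y \<odot> P) \<odot> Q))"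
proof -
  define k where "k Z = Inv B (assoc B Z P Q) \<cdot> ((\<one> Z \<otimes> e) \<cdot> Inv B (runit B Z))" for Z
  have U: "U R \<in> Cell B R R" using unit_cell cell_obj[OF P] by blast
  have PQ: "P \<odot> Q \<in> Cell B R R" using hcmp1_cell P Q by blast
  have P1: "\<one> P \<in> Hom B P P" and Q1: "\<one> Q \<in> Hom B Q Q" using idt_hom cell_ob P Q by blast+
  have k1: "(\<one> Z \<otimes> e) \<cdot> Inv B (runit B Z) \<in> Iso B Z (Z \<odot> (P \<odot> Q))" if "Z \<in> Cell B T R" for Z
    using iso_cmp[OF Inv_iso[OF runit_iso[OF that]] hcmp2_iso[OF that U idt_cell[OF that] e]] .
  have k: "k Z \<in> Iso B Z ((Z \<odot> P) \<odot> Q)" if "Z \<in> Cell B T R" for Z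
    unfolding k_def using iso_cmp[OF k1[OF that] Inv_iso[OF assoc_iso[OF that P Q]]] .
  have Fh: "(h \<otimes> \<one> P) \<otimes> \<one> Q \<in> Hom B ((X \<odot> P) \<odot> Q) ((Y \<odot> P) \<odot> Q)" if h: "h \<in> Hom B X Y" for h
    using hcmp2_hom[OF hcmp1_cell[OF X P] Q hcmp2_hom[OF X P h P1] Q1] .
  have "k Y \<cdot> h = ((h \<otimes> \<one> P) \<otimes> \<one> Q) \<cdot> k X" if h: "h \<in> Hom B X Y" for h
  proof -
    have Uh: "h \<otimes> \<one> (U R) \<in> Hom B (X \<odot> U R) (Y \<odot> U R)"
      using hcmp2_hom[OF X U] idt_hom cell_ob U h by blast
    have rX: "Inv B (runit B X) \<in> Hom B X (X \<odot> U R)" and rY: "Inv B (runit B Y) \<in> Hom B Y (Y \<odot> U R)"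
      using Inv_hom runit_iso X Y by blast+
    have eX: "\<one> X \<otimes> e \<in> Hom B (X \<odot> U R) (X \<odot> (P \<odot> Q))" and eY: "\<one> Y \<otimes> e \<in> Hom B (Y \<odot> U R) (Y \<odot> (P \<odot> Q))"
      using hcmp2_iso[OF X U idt_cell[OF X] e] hcmp2_iso[OF Y U idt_cell[OF Y] e] iso_hom by blast+
    have aX: "Inv B (assoc B X P Q) \<in> Hom B (X \<odot> (P \<odot> Q)) ((X \<odot> P) \<odot> Q)"
      and aY: "Inv B (assoc B Y P Q) \<in> Hom B (Y \<odot> (P \<odot> Q)) ((Y \<odot> P) \<odot> Q)"
      using assoc_iso P Q X Y Inv_hom by blast+
    have PQh: "h \<otimes> \<one> (P \<odot> Q) \<in> Hom B (X \<odot> (P \<odot> Q)) (Y \<odot> (P \<odot> Q))"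
      using hcmp2_hom[OF X PQ] idt_hom cell_ob PQ h by blast
    have "((\<one> Y \<otimes> e) \<cdot> Inv B (runit B Y)) \<cdot> h = (\<one> Y \<otimes> e) \<cdot> (Inv B (runit B Y) \<cdot> h)"
      using cmp_assoc[OF h rY eY] .
    also have "\<dots> = (\<one> Y \<otimes> e) \<cdot> ((h \<otimes> \<one> (U R)) \<cdot> Inv B (runit B X))"
      using natural_inverse[OF runit_iso[OF X] runit_iso[OF Y] Uh h runit_natural[OF X h]] by simp
    also have "\<dots> = ((h \<otimes> \<one> (P \<odot> Q)) \<cdot> (\<one> X \<otimes> e)) \<cdot> Inv B (runit B X)"
      using cmp_assoc[OF rX Uh eY] hcmp2_interchange[OF X U h iso_hom[OF e]] by simp
    also have "\<dots> = (h \<otimes> \<one> (P \<odot> Q)) \<cdot> ((\<one> X \<otimes> e) \<cdot> Inv B (runit B X))"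
      using cmp_assoc[OF rX eX PQh] .
    finally have 1: "((\<one> Y \<otimes> e) \<cdot> Inv B (runit B Y)) \<cdot> h
      = (h \<otimes> \<one> (P \<odot> Q)) \<cdot> ((\<one> X \<otimes> e) \<cdot> Inv B (runit B X))" .
    have 2: "Inv B (assoc B Y P Q) \<cdot> (h \<otimes> \<one> (P \<odot> Q)) = ((h \<otimes> \<one> P) \<otimes> \<one> Q) \<cdot> Inv B (assoc B X P Q)"
      using natural_inverse[OF assoc_iso[OF X P Q] assoc_iso[OF Y P Q] Fh[OF h] PQh]
        assoc_natural[OF X P Q h P1 Q1] hcmp2_idt[OF P Q] by simp
    have "k Y \<cdot> h = Inv B (assoc B Y P Q) \<cdot> (((\<one> Y \<otimes> e) \<cdot> Inv B (runit B Y)) \<cdot> h)"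
      unfolding k_def using cmp_assoc[OF h cmp_hom[OF rY eY] aY] .
    also have "\<dots> = (((h \<otimes> \<one> P) \<otimes> \<one> Q) \<cdot> Inv B (assoc B X P Q)) \<cdot> ((\<one> X \<otimes> e) \<cdot> Inv B (runit B X))"
      using 1 2 cmp_assoc[OF cmp_hom[OF rX eX] PQh aY] by simp
    also have "\<dots> = ((h \<otimes> \<one> P) \<otimes> \<one> Q) \<cdot> k X"
      unfolding k_def using cmp_assoc[OF cmp_hom[OF rX eX] aX Fh[OF h]] .
    finally show ?thesis .
  qed
  then show ?thesis using Fh by (rule conjugation_bij[OF k[OF X] k[OF Y], rotated])
qed

text \<open>
  Tensoring with \<open>P\<close> inverts tensoring with \<open>Q\<close> up to isomorphism, in either order.
\<close>

lemma left_tensor_bij: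
  assumes P: "P \<in> Cell B R S" and Q: "Q \<in> Cell B S R"
    and e: "e \<in> Iso B (U R) (P \<odot> Q)" and d: "d \<in> Iso B (U S) (Q \<odot> P)"
    and X: "X \<in> Cell B R T" and Y: "Y \<in> Cell B R T"
  shows "bij_betw (\<lambda>h. \<one> Q \<otimes> h) (Hom B X Y) (Hom B (Q \<odot> X) (Q \<odot> Y))"
proof (rule bij_betw_if_composites)
  show "(\<lambda>h. \<one> Q \<otimes> h) ` Hom B X Y \<subseteq> Hom B (Q \<odot> X) (Q \<odot> Y)"
    using hcmp2_hom[OF Q X iso_hom[OF idt_cell[OF Q]]] by blast
  show "(\<lambda>h. \<one> P \<otimes> h) ` Hom B (Q \<odot> X) (Q \<odot> Y) \<subseteq> Hom B (P \<odot> (Q \<odot> X)) (P \<odot> (Q \<odot> Y))"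
    using hcmp2_hom[OF P hcmp1_cell[OF Q X] iso_hom[OF idt_cell[OF P]]] by blast
  show "bij_betw ((\<lambda>h. \<one> P \<otimes> h) \<circ> (\<lambda>h. \<one> Q \<otimes> h)) (Hom B X Y)
      (Hom B (P \<odot> (Q \<odot> X)) (P \<odot> (Q \<odot> Y)))"
    using left_tensor_composite_bij[OF P Q e X Y] by (simp add: comp_def)
  show "inj_on ((\<lambda>h. \<one> Q \<otimes> h) \<circ> (\<lambda>h. \<one> P \<otimes> h)) (Hom B (Q \<odot> X) (Q \<odot> Y))"
    using bij_betw_imp_inj_on[OF left_tensor_composite_bij[OF Q P d hcmp1_cell[OF Q X] hcmp1_cell[OF Q Y]]]
    by (simp add: comp_def)
qed

lemma right_tensor_bij:
  assumes P: "P \<in> Cell B R S" and Q: "Q \<in> Cell B S R"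
    and e: "e \<in> Iso B (U R) (P \<odot> Q)" and d: "d \<in> Iso B (U S) (Q \<odot> P)"
    and X: "X \<in> Cell B T S" and Y: "Y \<in> Cell B T S"
  shows "bij_betw (\<lambda>h. h \<otimes> \<one> Q) (Hom B X Y) (Hom B (X \<odot> Q) (Y \<odot> Q))"
proof (rule bij_betw_if_composites)
  show "(\<lambda>h. h \<otimes> \<one> Q) ` Hom B X Y \<subseteq> Hom B (X \<odot> Q) (Y \<odot> Q)"
    using hcmp2_hom[OF X Q _ iso_hom[OF idt_cell[OF Q]]] by blast
  show "(\<lambda>h. h \<otimes> \<one> P) ` Hom B (X \<odot> Q) (Y \<odot> Q) \<subseteq> Hom B ((X \<odot> Q) \<odot> P) ((Y \<odot> Q) \<odot> P)"
    using hcmp2_hom[OF hcmp1_cell[OF X Q] P _ iso_hom[OF idt_cell[OF P]]] by blast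
  show "bij_betw ((\<lambda>h. h \<otimes> \<one> P) \<circ> (\<lambda>h. h \<otimes> \<one> Q)) (Hom B X Y)
      (Hom B ((X \<odot> Q) \<odot> P) ((Y \<odot> Q) \<odot> P))"
    using right_tensor_composite_bij[OF Q P d X Y] by (simp add: comp_def)
  show "inj_on ((\<lambda>h. h \<otimes> \<one> Q) \<circ> (\<lambda>h. h \<otimes> \<one> P)) (Hom B (X \<odot> Q) (Y \<odot> Q))"
    using bij_betw_imp_inj_on[OF right_tensor_composite_bij[OF P Q e hcmp1_cell[OF X Q] hcmp1_cell[OF Y Q]]]
    by (simp add: comp_def)
qed

text \<open>
  The triangle identities of \<open>(Q, P)\<close> are the termwise inverses of those of \<open>(P, Q)\<close>, with their
  roles exchanged.
\<close>

lemma dual_pair_reverse: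
  assumes P: "P \<in> Cell B R S" and Q: "Q \<in> Cell B S R"
    and \<eta>: "\<eta> \<in> Iso B (U R) (P \<odot> Q)" and \<epsilon>: "\<epsilon> \<in> Iso B (Q \<odot> P) (U S)"
    and tri: "triangle_identities B P Q \<eta> \<epsilon>"
  shows "dual_pair B S R Q P (Inv B \<epsilon>) (Inv B \<eta>)"
proof -
  have UR: "U R \<in> Cell B R R" and US: "U S \<in> Cell B S S" using unit_cell cell_obj[OF P] by blast+
  have PQ: "P \<odot> Q \<in> Cell B R R" and QP: "Q \<odot> P \<in> Cell B S S" using hcmp1_cell P Q by blast+
  note P1 = idt_cell[OF P] and Q1 = idt_cell[OF Q]
  have IP: "Inv B (\<one> P) = \<one> P" and IQ: "Inv B (\<one> Q) = \<one> Q" using Inv_idt cell_ob P Q by blast+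
  note P\<epsilon> = hcmp2_iso[OF P QP P1 \<epsilon>] and \<eta>P = hcmp2_iso[OF UR P \<eta> P1]
    and \<epsilon>Q = hcmp2_iso[OF QP Q \<epsilon> Q1] and Q\<eta> = hcmp2_iso[OF Q UR Q1 \<eta>]
  note iP\<epsilon> = hcmp2_Inv[OF P QP P1 \<epsilon>] and i\<eta>P = hcmp2_Inv[OF UR P \<eta> P1]
    and i\<epsilon>Q = hcmp2_Inv[OF QP Q \<epsilon> Q1] and iQ\<eta> = hcmp2_Inv[OF Q UR Q1 \<eta>]
  note lP = lunit_iso[OF P] and rP = runit_iso[OF P] and lQ = lunit_iso[OF Q] and rQ = runit_iso[OF Q]
    and aP = assoc_iso[OF P Q P] and aQ = assoc_iso[OF Q P Q]
  have 1: "Inv B (runit B P \<cdot> (\<one> P \<otimes> \<epsilon>) \<cdot> assoc B P Q P \<cdot> (\<eta> \<otimes> \<one> P) \<cdot> Inv B (lunit B P)) = \<one> P"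
    using tri IP by (simp add: triangle_identities_def)
  have 2: "Inv B (lunit B Q \<cdot> (\<epsilon> \<otimes> \<one> Q) \<cdot> Inv B (assoc B Q P Q) \<cdot> (\<one> Q \<otimes> \<eta>) \<cdot> Inv B (runit B Q)) = \<one> Q"
    using tri IQ by (simp add: triangle_identities_def)
  have 3: "lunit B P \<cdot> (Inv B \<eta> \<otimes> \<one> P) \<cdot> Inv B (assoc B P Q P) \<cdot> (\<one> P \<otimes> Inv B \<epsilon>) \<cdot> Inv B (runit B P) = \<one> P"
    using 1 Inv_cmp5[OF Inv_iso[OF lP] \<eta>P aP P\<epsilon> rP] by (simp add: i\<eta>P iP\<epsilon> IP Inv_Inv[OF lP])
  have 4: "runit B Q \<cdot> (\<one> Q \<otimes> Inv B \<eta>) \<cdot> assoc B Q P Q \<cdot> (Inv B \<epsilon> \<otimes> \<one> Q) \<cdot> Inv B (lunit B Q) = \<one> Q"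
    using 2 Inv_cmp5[OF Inv_iso[OF rQ] Q\<eta> Inv_iso[OF aQ] \<epsilon>Q lQ]
    by (simp add: i\<epsilon>Q iQ\<eta> IQ Inv_Inv[OF rQ] Inv_Inv[OF aQ])
  show ?thesis unfolding dual_pair_def triangle_identities_def
    using P Q Inv_hom[OF \<eta>] Inv_hom[OF \<epsilon>] 3 4 by blast
qed

end

section \<open>Transposes and the canonical isomorphisms\<close>

context closed_bicategory
begin

lemma curryl_hom:
  "\<lbrakk>M \<in> Cell B R S; N \<in> Cell B S T; P \<in> Cell B R T; \<phi> \<in> Hom B (M \<odot> N) P\<rbrakk>
    \<Longrightarrow> curryl B M N P \<phi> \<in> Hom B N (P \<triangleleft> M)"
  using bij_betwE[OF curryl_bij] by blast

lemma curryr_hom: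
  "\<lbrakk>M \<in> Cell B R S; N \<in> Cell B S T; P \<in> Cell B R T; \<phi> \<in> Hom B (M \<odot> N) P\<rbrakk>
    \<Longrightarrow> curryr B M N P \<phi> \<in> Hom B M (N \<triangleright> P)"
  using bij_betwE[OF curryr_bij] by blast

lemma curryl_precompose:
  assumes M: "M \<in> Cell B R S" and N: "N \<in> Cell B S T" and P: "P \<in> Cell B R T"
    and \<phi>: "\<phi> \<in> Hom B (M \<odot> N) P" and h: "h \<in> Hom B N' N"
  shows "curryl B M N' P (\<phi> \<cdot> (\<one> M \<otimes> h)) = curryl B M N P \<phi> \<cdot> h"
  using curryl_natural[OF M N P iso_hom[OF idt_cell[OF M]] h iso_hom[OF idt_cell[OF P]] \<phi>]
    cmp_idt_left[OF \<phi>] lhom2_idt[OF P M] cmp_idt_left[OF curryl_hom[OF M N P \<phi>]] by simp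

lemma curryr_precompose:
  assumes M: "M \<in> Cell B R S" and N: "N \<in> Cell B S T" and P: "P \<in> Cell B R T"
    and \<phi>: "\<phi> \<in> Hom B (M \<odot> N) P" and h: "h \<in> Hom B M' M"
  shows "curryr B M' N P (\<phi> \<cdot> (h \<otimes> \<one> N)) = curryr B M N P \<phi> \<cdot> h"
  using curryr_natural[OF M N P h iso_hom[OF idt_cell[OF N]] iso_hom[OF idt_cell[OF P]] \<phi>]
    cmp_idt_left[OF \<phi>] rhom2_idt[OF N P] cmp_idt_left[OF curryr_hom[OF M N P \<phi>]] by simp

text \<open>
  By naturality of transposition, composing with the transpose of \<open>\<phi>\<close> is the bijection
  \<open>h \<mapsto> \<phi> \<cdot> (1 \<otimes> h)\<close> followed by transposition.
\<close>

lemma curryl_iso: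
  assumes M: "M \<in> Cell B R S" and N: "N \<in> Cell B S T" and P: "P \<in> Cell B R T"
    and \<phi>: "\<phi> \<in> Hom B (M \<odot> N) P"
    and universal: "\<And>Z. Z \<in> Cell B S T
      \<Longrightarrow> bij_betw (\<lambda>h. \<phi> \<cdot> (\<one> M \<otimes> h)) (Hom B Z N) (Hom B (M \<odot> Z) P)"
  shows "curryl B M N P \<phi> \<in> Iso B N (P \<triangleleft> M)"
proof -
  have "bij_betw (\<lambda>h. curryl B M N P \<phi> \<cdot> h) (Hom B Z N) (Hom B Z (P \<triangleleft> M))" if Z: "Z \<in> Cell B S T" for Z
    using bij_betw_trans[OF universal[OF Z] curryl_bij[OF M Z P]]
    by (simp add: comp_def curryl_precompose[OF M N P \<phi>] cong: bij_betw_cong)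
  then show ?thesis
    using iso_if_post_bij[OF curryl_hom[OF M N P \<phi>]] N lhom1_cell[OF P M] by blast
qed

lemma curryr_iso:
  assumes M: "M \<in> Cell B R S" and N: "N \<in> Cell B S T" and P: "P \<in> Cell B R T"
    and \<phi>: "\<phi> \<in> Hom B (M \<odot> N) P"
    and universal: "\<And>Z. Z \<in> Cell B R S
      \<Longrightarrow> bij_betw (\<lambda>h. \<phi> \<cdot> (h \<otimes> \<one> N)) (Hom B Z M) (Hom B (Z \<odot> N) P)"
  shows "curryr B M N P \<phi> \<in> Iso B M (N \<triangleright> P)"
proof -
  have "bij_betw (\<lambda>h. curryr B M N P \<phi> \<cdot> h) (Hom B Z M) (Hom B Z (N \<triangleright> P))" if Z: "Z \<in> Cell B R S" for Z
    using bij_betw_trans[OF universal[OF Z] curryr_bij[OF Z N P]]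
    by (simp add: comp_def curryr_precompose[OF M N P \<phi>] cong: bij_betw_cong)
  then show ?thesis
    using iso_if_post_bij[OF curryr_hom[OF M N P \<phi>]] M rhom1_cell[OF N P] by blast
qed

lemma
  assumes M: "M \<in> Cell B R S" and P: "P \<in> Cell B R T"
  shows evl_hom: "evl B M P \<in> Hom B (M \<odot> (P \<triangleleft> M)) P"
    and curryl_evl: "curryl B M (P \<triangleleft> M) P (evl B M P) = \<one> (P \<triangleleft> M)"
proof -
  note b = curryl_bij[OF M lhom1_cell[OF P M] P]
  have i: "\<one> (P \<triangleleft> M) \<in> Hom B (P \<triangleleft> M) (P \<triangleleft> M)"
    using idt_hom cell_ob lhom1_cell[OF P M] by blast
  show "evl B M P \<in> Hom B (M \<odot> (P \<triangleleft> M)) P"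
    unfolding evl_def uncurryl_def using bij_betwE[OF bij_betw_the_inv_into[OF b]] i by blast
  show "curryl B M (P \<triangleleft> M) P (evl B M P) = \<one> (P \<triangleleft> M)"
    unfolding evl_def uncurryl_def using f_the_inv_into_f_bij_betw[OF b] i by blast
qed

lemma
  assumes N: "N \<in> Cell B S T" and P: "P \<in> Cell B R T"
  shows evr_hom: "evr B N P \<in> Hom B ((N \<triangleright> P) \<odot> N) P"
    and curryr_evr: "curryr B (N \<triangleright> P) N P (evr B N P) = \<one> (N \<triangleright> P)"
proof -
  note b = curryr_bij[OF rhom1_cell[OF N P] N P]
  have i: "\<one> (N \<triangleright> P) \<in> Hom B (N \<triangleright> P) (N \<triangleright> P)"
    using idt_hom cell_ob rhom1_cell[OF N P] by blast
  show "evr B N P \<in> Hom B ((N \<triangleright> P) \<odot> N) P"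
    unfolding evr_def uncurryr_def using bij_betwE[OF bij_betw_the_inv_into[OF b]] i by blast
  show "curryr B (N \<triangleright> P) N P (evr B N P) = \<one> (N \<triangleright> P)"
    unfolding evr_def uncurryr_def using f_the_inv_into_f_bij_betw[OF b] i by blast
qed

text \<open>
  The map \<open>h \<mapsto> evl \<cdot> (1 \<otimes> h)\<close> undoes transposition.
\<close>

lemma evl_universal:
  assumes M: "M \<in> Cell B R S" and P: "P \<in> Cell B R T" and Z: "Z \<in> Cell B S T"
  shows "bij_betw (\<lambda>h. evl B M P \<cdot> (\<one> M \<otimes> h)) (Hom B Z (P \<triangleleft> M)) (Hom B (M \<odot> Z) P)"
proof (rule bij_betw_if_composites)
  note PM = lhom1_cell[OF P M]
  show "(\<lambda>h. evl B M P \<cdot> (\<one> M \<otimes> h)) ` Hom B Z (P \<triangleleft> M) \<subseteq> Hom B (M \<odot> Z) P"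
    using cmp_hom[OF hcmp2_hom[OF M Z iso_hom[OF idt_cell[OF M]]] evl_hom[OF M P]] by blast
  show "curryl B M Z P ` Hom B (M \<odot> Z) P \<subseteq> Hom B Z (P \<triangleleft> M)"
    using curryl_hom[OF M Z P] by blast
  show "bij_betw (curryl B M Z P \<circ> (\<lambda>h. evl B M P \<cdot> (\<one> M \<otimes> h))) (Hom B Z (P \<triangleleft> M)) (Hom B Z (P \<triangleleft> M))"
    using bij_betw_id
    by (simp add: comp_def curryl_precompose[OF M PM P evl_hom[OF M P]] curryl_evl[OF M P] cmp_idt_left id_def
        cong: bij_betw_cong)
  show "inj_on (id \<circ> curryl B M Z P) (Hom B (M \<odot> Z) P)"
    using bij_betw_imp_inj_on[OF curryl_bij[OF M Z P]] by simp
qed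

lemma evr_universal:
  assumes N: "N \<in> Cell B S T" and P: "P \<in> Cell B R T" and Z: "Z \<in> Cell B R S"
  shows "bij_betw (\<lambda>h. evr B N P \<cdot> (h \<otimes> \<one> N)) (Hom B Z (N \<triangleright> P)) (Hom B (Z \<odot> N) P)"
proof (rule bij_betw_if_composites)
  note NP = rhom1_cell[OF N P]
  show "(\<lambda>h. evr B N P \<cdot> (h \<otimes> \<one> N)) ` Hom B Z (N \<triangleright> P) \<subseteq> Hom B (Z \<odot> N) P"
    using cmp_hom[OF hcmp2_hom[OF Z N _ iso_hom[OF idt_cell[OF N]]] evr_hom[OF N P]] by blast
  show "curryr B Z N P ` Hom B (Z \<odot> N) P \<subseteq> Hom B Z (N \<triangleright> P)"
    using curryr_hom[OF Z N P] by blast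
  show "bij_betw (curryr B Z N P \<circ> (\<lambda>h. evr B N P \<cdot> (h \<otimes> \<one> N))) (Hom B Z (N \<triangleright> P)) (Hom B Z (N \<triangleright> P))"
    using bij_betw_id
    by (simp add: comp_def curryr_precompose[OF NP N P evr_hom[OF N P]] curryr_evr[OF N P] cmp_idt_left id_def
        cong: bij_betw_cong)
  show "inj_on (id \<circ> curryr B Z N P) (Hom B (Z \<odot> N) P)"
    using bij_betw_imp_inj_on[OF curryr_bij[OF Z N P]] by simp
qed

lemma lbar_iso:
  assumes M: "M \<in> Cell B R S"
  shows "lbar B M \<in> Iso B M (M \<triangleleft> U R)"
proof -
  have U: "U R \<in> Cell B R R" using unit_cell cell_obj[OF M] by blast
  have "curryl B (U R) M M (lunit B M) \<in> Iso B M (M \<triangleleft> U R)"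
  proof (rule curryl_iso[OF U M M iso_hom[OF lunit_iso[OF M]]])
    fix Z assume Z: "Z \<in> Cell B R S"
    show "bij_betw (\<lambda>h. lunit B M \<cdot> (\<one> (U R) \<otimes> h)) (Hom B Z M) (Hom B (U R \<odot> Z) M)"
      using iso_pre_bij[OF lunit_iso[OF Z]] by (simp add: lunit_natural[OF Z] cong: bij_betw_cong)
  qed
  then show ?thesis using M by (simp add: lbar_def Cell_def)
qed

lemma rbar_iso:
  assumes M: "M \<in> Cell B R S"
  shows "rbar B M \<in> Iso B M (U S \<triangleright> M)"
proof -
  have U: "U S \<in> Cell B S S" using unit_cell cell_obj[OF M] by blast
  have "curryr B M (U S) M (runit B M) \<in> Iso B M (U S \<triangleright> M)"
  proof (rule curryr_iso[OF M U M iso_hom[OF runit_iso[OF M]]])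
    fix Z assume Z: "Z \<in> Cell B R S"
    show "bij_betw (\<lambda>h. runit B M \<cdot> (h \<otimes> \<one> (U S))) (Hom B Z M) (Hom B (Z \<odot> U S) M)"
      using iso_pre_bij[OF runit_iso[OF Z]] by (simp add: runit_natural[OF Z] cong: bij_betw_cong)
  qed
  then show ?thesis using M by (simp add: rbar_def Cell_def)
qed

text \<open>
  A 2-cell \<open>Z \<rightarrow> (M \<odot> N) \<triangleright> P\<close> amounts to one \<open>Z \<odot> (M \<odot> N) \<rightarrow> P\<close>, by reassociation to one
  \<open>(Z \<odot> M) \<odot> N \<rightarrow> P\<close>, and hence to one \<open>Z \<odot> M \<rightarrow> N \<triangleright> P\<close>.  Naturality of the associator and of
  transposition identifies this correspondence with the map that defines \<open>tright\<close>.
\<close>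

lemma tright_iso:
  assumes M: "M \<in> Cell B R S" and N: "N \<in> Cell B S V" and P: "P \<in> Cell B A V"
  shows "tright B M N P \<in> Iso B ((M \<odot> N) \<triangleright> P) (M \<triangleright> (N \<triangleright> P))"
proof -
  have MN: "M \<odot> N \<in> Cell B R V" and NP: "N \<triangleright> P \<in> Cell B A S" using hcmp1_cell M N rhom1_cell P by blast+
  define X where "X = (M \<odot> N) \<triangleright> P"
  have X: "X \<in> Cell B A R" and XM: "X \<odot> M \<in> Cell B A S"
    unfolding X_def using rhom1_cell[OF MN P] hcmp1_cell M by blast+
  define \<psi> where "\<psi> = evr B (M \<odot> N) P \<cdot> assoc B X M N"
  have ev: "evr B (M \<odot> N) P \<in> Hom B (X \<odot> (M \<odot> N)) P" unfolding X_def using evr_hom[OF MN P] .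
  note aX = iso_hom[OF assoc_iso[OF X M N]]
  have \<psi>: "\<psi> \<in> Hom B ((X \<odot> M) \<odot> N) P" unfolding \<psi>_def using cmp_hom[OF aX ev] .
  note M1 = iso_hom[OF idt_cell[OF M]] and N1 = iso_hom[OF idt_cell[OF N]] and MN1 = iso_hom[OF idt_cell[OF MN]]
  have "curryr B X M (N \<triangleright> P) (curryr B (X \<odot> M) N P \<psi>) \<in> Iso B X (M \<triangleright> (N \<triangleright> P))"
  proof (rule curryr_iso[OF X M NP curryr_hom[OF XM N P \<psi>]])
    fix Z assume Z: "Z \<in> Cell B A R"
    note ZM = hcmp1_cell[OF Z M]
    have "curryr B (X \<odot> M) N P \<psi> \<cdot> (h \<otimes> \<one> M)
        = curryr B (Z \<odot> M) N P ((evr B (M \<odot> N) P \<cdot> (h \<otimes> \<one> (M \<odot> N))) \<cdot> assoc B Z M N)"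
      if h: "h \<in> Hom B Z X" for h
    proof -
      note hM = hcmp2_hom[OF Z M h M1]
      have "curryr B (X \<odot> M) N P \<psi> \<cdot> (h \<otimes> \<one> M) = curryr B (Z \<odot> M) N P (\<psi> \<cdot> ((h \<otimes> \<one> M) \<otimes> \<one> N))"
        using curryr_precompose[OF XM N P \<psi> hM] by simp
      also have "\<psi> \<cdot> ((h \<otimes> \<one> M) \<otimes> \<one> N) = (evr B (M \<odot> N) P \<cdot> (h \<otimes> \<one> (M \<odot> N))) \<cdot> assoc B Z M N"
        unfolding \<psi>_def
        using cmp_assoc[OF hcmp2_hom[OF ZM N hM N1] aX ev] assoc_natural[OF Z M N h M1 N1] hcmp2_idt[OF M N]
          cmp_assoc[OF iso_hom[OF assoc_iso[OF Z M N]] hcmp2_hom[OF Z MN h MN1] ev] by simp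
      finally show ?thesis .
    qed
    then show "bij_betw (\<lambda>h. curryr B (X \<odot> M) N P \<psi> \<cdot> (h \<otimes> \<one> M)) (Hom B Z X) (Hom B (Z \<odot> M) (N \<triangleright> P))"
      using bij_betw_trans[OF bij_betw_trans[OF evr_universal[OF MN P Z, folded X_def] iso_pre_bij[OF assoc_iso[OF Z M N]]]
          curryr_bij[OF ZM N P]]
      by (simp add: comp_def cong: bij_betw_cong)
  qed
  then show ?thesis by (simp add: tright_def Let_def X_def \<psi>_def)
qed

lemma tleft_iso:
  assumes P: "P \<in> Cell B R A" and M: "M \<in> Cell B R S" and N: "N \<in> Cell B S V"
  shows "tleft B P M N \<in> Iso B (P \<triangleleft> (M \<odot> N)) ((P \<triangleleft> M) \<triangleleft> N)"
proof -
  have MN: "M \<odot> N \<in> Cell B R V" and PM: "P \<triangleleft> M \<in> Cell B S A" using hcmp1_cell M N lhom1_cell P by blast+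
  define Y where "Y = P \<triangleleft> (M \<odot> N)"
  have Y: "Y \<in> Cell B V A" and NY: "N \<odot> Y \<in> Cell B S A"
    unfolding Y_def using lhom1_cell[OF P MN] hcmp1_cell N by blast+
  define \<psi> where "\<psi> = evl B (M \<odot> N) P \<cdot> Inv B (assoc B M N Y)"
  have ev: "evl B (M \<odot> N) P \<in> Hom B ((M \<odot> N) \<odot> Y) P" unfolding Y_def using evl_hom[OF MN P] .
  note aY = Inv_hom[OF assoc_iso[OF M N Y]]
  have \<psi>: "\<psi> \<in> Hom B (M \<odot> (N \<odot> Y)) P" unfolding \<psi>_def using cmp_hom[OF aY ev] .
  note M1 = iso_hom[OF idt_cell[OF M]] and N1 = iso_hom[OF idt_cell[OF N]] and MN1 = iso_hom[OF idt_cell[OF MN]]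
  have "curryl B N Y (P \<triangleleft> M) (curryl B M (N \<odot> Y) P \<psi>) \<in> Iso B Y ((P \<triangleleft> M) \<triangleleft> N)"
  proof (rule curryl_iso[OF N Y PM curryl_hom[OF M NY P \<psi>]])
    fix Z assume Z: "Z \<in> Cell B V A"
    note NZ = hcmp1_cell[OF N Z]
    have "curryl B M (N \<odot> Y) P \<psi> \<cdot> (\<one> N \<otimes> h)
        = curryl B M (N \<odot> Z) P ((evl B (M \<odot> N) P \<cdot> (\<one> (M \<odot> N) \<otimes> h)) \<cdot> Inv B (assoc B M N Z))"
      if h: "h \<in> Hom B Z Y" for h
    proof -
      note Nh = hcmp2_hom[OF N Z N1 h] and MNh = hcmp2_hom[OF MN Z MN1 h]
      note MNh' = hcmp2_hom[OF M NZ M1 Nh]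
      have "curryl B M (N \<odot> Y) P \<psi> \<cdot> (\<one> N \<otimes> h) = curryl B M (N \<odot> Z) P (\<psi> \<cdot> (\<one> M \<otimes> (\<one> N \<otimes> h)))"
        using curryl_precompose[OF M NY P \<psi> Nh] by simp
      also have "\<psi> \<cdot> (\<one> M \<otimes> (\<one> N \<otimes> h)) = (evl B (M \<odot> N) P \<cdot> (\<one> (M \<odot> N) \<otimes> h)) \<cdot> Inv B (assoc B M N Z)"
        unfolding \<psi>_def
        using cmp_assoc[OF MNh' aY ev] cmp_assoc[OF Inv_hom[OF assoc_iso[OF M N Z]] MNh ev]
          natural_inverse[OF assoc_iso[OF M N Z] assoc_iso[OF M N Y] MNh MNh']
          assoc_natural[OF M N Z M1 N1 h] hcmp2_idt[OF M N] by simp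
      finally show ?thesis .
    qed
    then show "bij_betw (\<lambda>h. curryl B M (N \<odot> Y) P \<psi> \<cdot> (\<one> N \<otimes> h)) (Hom B Z Y) (Hom B (N \<odot> Z) (P \<triangleleft> M))"
      using bij_betw_trans[OF bij_betw_trans[OF evl_universal[OF MN P Z, folded Y_def]
            iso_pre_bij[OF Inv_iso[OF assoc_iso[OF M N Z]]]] curryl_bij[OF M NZ P]]
      by (simp add: comp_def cong: bij_betw_cong)
  qed
  then show ?thesis by (simp add: tleft_def Let_def Y_def \<psi>_def)
qed

lemma lhom2_iso:
  assumes P: "P \<in> Cell B R T" and M: "M \<in> Cell B R S"
    and \<pi>: "\<pi> \<in> Iso B P P'" and \<mu>: "\<mu> \<in> Iso B M' M"
  shows "\<pi> \<lhd> \<mu> \<in> Iso B (P \<triangleleft> M) (P' \<triangleleft> M')"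
proof -
  note ph = iso_hom[OF \<pi>] and pi = Inv_hom[OF \<pi>] and mh = iso_hom[OF \<mu>] and mi = Inv_hom[OF \<mu>]
  have P': "P' \<in> Cell B R T" using cell_hom P ph by blast
  have M': "M' \<in> Cell B R S" using cell_hom M mi by blast
  have 1: "(Inv B \<pi> \<lhd> Inv B \<mu>) \<cdot> (\<pi> \<lhd> \<mu>) = \<one> (P \<triangleleft> M)"
    using lhom2_cmp[OF P M ph pi mh mi] Inv_left[OF \<pi>] Inv_right[OF \<mu>] lhom2_idt[OF P M] by simp
  have 2: "(\<pi> \<lhd> \<mu>) \<cdot> (Inv B \<pi> \<lhd> Inv B \<mu>) = \<one> (P' \<triangleleft> M')"
    using lhom2_cmp[OF P' M' pi ph mi mh] Inv_right[OF \<pi>] Inv_left[OF \<mu>] lhom2_idt[OF P' M'] by simp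
  show ?thesis using isoI[OF lhom2_hom[OF P M ph mh] lhom2_hom[OF P' M' pi mi] 1 2] .
qed

lemma rhom2_iso:
  assumes N: "N \<in> Cell B S T" and P: "P \<in> Cell B R T"
    and \<nu>: "\<nu> \<in> Iso B N' N" and \<pi>: "\<pi> \<in> Iso B P P'"
  shows "\<nu> \<rhd> \<pi> \<in> Iso B (N \<triangleright> P) (N' \<triangleright> P')"
proof -
  note ph = iso_hom[OF \<pi>] and pi = Inv_hom[OF \<pi>] and nh = iso_hom[OF \<nu>] and ni = Inv_hom[OF \<nu>]
  have P': "P' \<in> Cell B R T" using cell_hom P ph by blast
  have N': "N' \<in> Cell B S T" using cell_hom N ni by blast
  have 1: "(Inv B \<nu> \<rhd> Inv B \<pi>) \<cdot> (\<nu> \<rhd> \<pi>) = \<one> (N \<triangleright> P)"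
    using rhom2_cmp[OF N P nh ni ph pi] Inv_left[OF \<pi>] Inv_right[OF \<nu>] rhom2_idt[OF N P] by simp
  have 2: "(\<nu> \<rhd> \<pi>) \<cdot> (Inv B \<nu> \<rhd> Inv B \<pi>) = \<one> (N' \<triangleright> P')"
    using rhom2_cmp[OF N' P' ni nh pi ph] Inv_right[OF \<pi>] Inv_left[OF \<nu>] rhom2_idt[OF N' P'] by simp
  show ?thesis using isoI[OF rhom2_hom[OF N P nh ph] rhom2_hom[OF N' P' ni pi] 1 2] .
qed

text \<open>
  The witness is the transpose of \<open>(M \<odot> P) \<odot> Q \<cong> M \<odot> (P \<odot> Q) \<cong> M \<odot> U \<cong> M\<close>.
\<close>

lemma rhom_along_invertible:
  assumes P: "P \<in> Cell B R S" and Q: "Q \<in> Cell B S R"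
    and e: "e \<in> Iso B (U R) (P \<odot> Q)" and d: "d \<in> Iso B (U S) (Q \<odot> P)" and M: "M \<in> Cell B A R"
  shows "\<exists>g. g \<in> Iso B (M \<odot> P) (Q \<triangleright> M)"
proof -
  note MP = hcmp1_cell[OF M P]
  have U: "U R \<in> Cell B R R" using unit_cell cell_obj[OF P] by blast
  define \<phi> where "\<phi> = runit B M \<cdot> ((\<one> M \<otimes> Inv B e) \<cdot> assoc B M P Q)"
  have \<phi>: "\<phi> \<in> Iso B ((M \<odot> P) \<odot> Q) M"
    unfolding \<phi>_def
    using iso_cmp[OF iso_cmp[OF assoc_iso[OF M P Q]
          hcmp2_iso[OF M hcmp1_cell[OF P Q] idt_cell[OF M] Inv_iso[OF e]]] runit_iso[OF M]] .
  have "curryr B (M \<odot> P) Q M \<phi> \<in> Iso B (M \<odot> P) (Q \<triangleright> M)"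
  proof (rule curryr_iso[OF MP Q M iso_hom[OF \<phi>]])
    fix Z assume Z: "Z \<in> Cell B A S"
    show "bij_betw (\<lambda>h. \<phi> \<cdot> (h \<otimes> \<one> Q)) (Hom B Z (M \<odot> P)) (Hom B (Z \<odot> Q) M)"
      using bij_betw_trans[OF right_tensor_bij[OF P Q e d Z MP] iso_post_bij[OF \<phi>]] by (simp add: comp_def)
  qed
  then show ?thesis by blast
qed

lemma lhom_along_invertible:
  assumes P: "P \<in> Cell B R S" and Q: "Q \<in> Cell B S R"
    and e: "e \<in> Iso B (U R) (P \<odot> Q)" and d: "d \<in> Iso B (U S) (Q \<odot> P)"
    and X: "X \<in> Cell B R A" and \<phi>: "\<phi> \<in> Iso B (Q \<odot> X) Y"
  shows "\<exists>g. g \<in> Iso B X (Y \<triangleleft> Q)"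
proof -
  have Y: "Y \<in> Cell B S A" using cell_hom hcmp1_cell[OF Q X] iso_hom[OF \<phi>] by blast
  have "curryl B Q X Y \<phi> \<in> Iso B X (Y \<triangleleft> Q)"
  proof (rule curryl_iso[OF Q X Y iso_hom[OF \<phi>]])
    fix Z assume Z: "Z \<in> Cell B R A"
    show "bij_betw (\<lambda>h. \<phi> \<cdot> (\<one> Q \<otimes> h)) (Hom B Z X) (Hom B (Q \<odot> Z) Y)"
      using bij_betw_trans[OF left_tensor_bij[OF P Q e d Z X] iso_post_bij[OF \<phi>]] by (simp add: comp_def)
  qed
  then show ?thesis by blast
qed

end

section \<open>Cotraces of isomorphisms\<close>

context coshadow
begin

lemma Csh2_iso:
  assumes M: "M \<in> Cell B R R" and a: "\<alpha> \<in> Iso B M N"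
  shows "Csh2 K \<alpha> \<in> Iso T (Csh1 K M) (Csh1 K N)"
proof -
  note ah = iso_hom[OF a] and ai = Inv_hom[OF a]
  have N: "N \<in> Cell B R R" using cell_hom M ah by blast
  show ?thesis
    using T.isoI[OF Csh2_hom[OF M ah] Csh2_hom[OF N ai]] Csh2_cmp[OF M ah ai] Csh2_cmp[OF N ai ah]
      Csh2_idt[OF M] Csh2_idt[OF N] Inv_left[OF a] Inv_right[OF a] by simp
qed

lemma cotrace_iso:
  assumes M: "M \<in> Cell B R S" and M': "M' \<in> Cell B S R"
    and \<eta>: "\<eta> \<in> Iso B (U R) (M \<odot> M')" and \<epsilon>: "\<epsilon> \<in> Iso B (M' \<odot> M) (U S)"
    and Q: "Q \<in> Cell B S S" and P: "P \<in> Cell B R R"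
    and f: "f \<in> Iso B (M \<triangleright> Q) (P \<triangleleft> M)"
  shows "cotrace B T K M M' \<eta> \<epsilon> Q P f \<in> Iso T (Csh1 K Q) (Csh1 K P)"
proof -
  have UR: "U R \<in> Cell B R R" and US: "U S \<in> Cell B S S" using unit_cell cell_obj[OF M] by blast+
  note MM' = hcmp1_cell[OF M M'] and PM = lhom1_cell[OF P M]
  have "(\<one> M' \<rhd> f) \<cdot> tright B M' M Q \<in> Iso B ((M' \<odot> M) \<triangleright> Q) (M' \<triangleright> (P \<triangleleft> M))"
    using iso_cmp[OF tright_iso[OF M' M Q] rhom2_iso[OF M' rhom1_cell[OF M Q] idt_cell[OF M'] f]] .
  then have "(\<one> M' \<rhd> f) \<cdot> tright B M' M Q \<cdot> (\<epsilon> \<rhd> \<one> Q) \<cdot> rbar B Q \<in> Iso B Q (M' \<triangleright> (P \<triangleleft> M))"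
    using iso_cmp rbar_iso[OF Q] rhom2_iso[OF US Q \<epsilon> idt_cell[OF Q]] by blast
  note before = Csh2_iso[OF Q this]
  have "Inv B (lbar B P) \<cdot> (\<one> P \<lhd> \<eta>) \<cdot> Inv B (tleft B P M M') \<in> Iso B ((P \<triangleleft> M) \<triangleleft> M') P"
    using iso_cmp[OF Inv_iso[OF tleft_iso[OF P M M']]
        iso_cmp[OF lhom2_iso[OF P MM' idt_cell[OF P] \<eta>] Inv_iso[OF lbar_iso[OF P]]]] .
  note after = Csh2_iso[OF lhom1_cell[OF PM M'] this]
  show ?thesis
    unfolding cotrace_def
    using T.iso_cmp[OF before T.iso_cmp[OF theta_iso[OF M' PM] after]] .
qed

end

theorem proposition8p5:
  fixes B :: "('o, 'm, 'c, 'z) closed_bicat_scheme"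
    and T :: "('t, 'u, 'y) cat_scheme"
    and K :: "('m, 'c, 't, 'u, 'x) coshadow_data_scheme"
  assumes "closed_bicategory B"
    and "category T"
    and "coshadow B T K"
    and "R \<in> Obj B" and "S \<in> Obj B"
    and "morita_equivalence B R S P Q \<eta> \<epsilon>"
    and "M \<in> Cell B R R"
  shows "isomorphic T (Csh1 K M) (Csh1 K ((Q \<odot>\<^bsub>B\<^esub> M) \<odot>\<^bsub>B\<^esub> P)) \<and>
    (\<exists>N N' \<eta>' \<epsilon>' f. right_dualizable B S R N \<and>
       dual_pair B S R N N' \<eta>' \<epsilon>' \<and>
       f \<in> Hom B (N \<triangleright>\<^bsub>B\<^esub> M) (((Q \<odot>\<^bsub>B\<^esub> M) \<odot>\<^bsub>B\<^esub> P) \<triangleleft>\<^bsub>B\<^esub> N) \<and>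
       cotrace B T K N N' \<eta>' \<epsilon>' M ((Q \<odot>\<^bsub>B\<^esub> M) \<odot>\<^bsub>B\<^esub> P) f
         \<in> Iso T (Csh1 K M) (Csh1 K ((Q \<odot>\<^bsub>B\<^esub> M) \<odot>\<^bsub>B\<^esub> P)))"
proof -
  interpret coshadow B T K by fact
  note M = \<open>M \<in> Cell B R R\<close>
  have P: "P \<in> Cell B R S" and Q: "Q \<in> Cell B S R"
    and \<eta>: "\<eta> \<in> Iso B (unit B R) (hcmp1 B P Q)" and \<epsilon>: "\<epsilon> \<in> Iso B (hcmp1 B Q P) (unit B S)"
    and tri: "triangle_identities B P Q \<eta> \<epsilon>"
    using \<open>morita_equivalence B R S P Q \<eta> \<epsilon>\<close> by (auto simp: morita_equivalence_def)
  \<comment> \<open>Both ends of \<open>f\<close> are compared with \<open>M \<odot> P\<close>; the comparison with \<open>W \<triangleleft> Q\<close> rests on the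
    inverse associator \<open>Q \<odot> (M \<odot> P) \<rightarrow> W\<close>.\<close>
  define W where "W = hcmp1 B (hcmp1 B Q M) P"
  note MP = hcmp1_cell[OF M P] and dual = dual_pair_reverse[OF P Q \<eta> \<epsilon> tri]
  have W: "W \<in> Cell B S S" unfolding W_def using hcmp1_cell[OF hcmp1_cell[OF Q M] P] .
  obtain g where g: "g \<in> Iso B (hcmp1 B M P) (rhom1 B Q M)"
    using rhom_along_invertible[OF P Q \<eta> Inv_iso[OF \<epsilon>] M] by blast
  obtain k where k: "k \<in> Iso B (hcmp1 B M P) (lhom1 B W Q)"
    using lhom_along_invertible[OF P Q \<eta> Inv_iso[OF \<epsilon>] MP Inv_iso[OF assoc_iso[OF Q M P]]]
    unfolding W_def by blast
  have f: "cmp B k (Inv B g) \<in> Iso B (rhom1 B Q M) (lhom1 B W Q)"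
    using iso_cmp[OF Inv_iso[OF g] k] .
  note cotr = cotrace_iso[OF Q P Inv_iso[OF \<epsilon>] Inv_iso[OF \<eta>] M W f]
  show ?thesis
    using dual cotr iso_hom[OF f] unfolding W_def isomorphic_def right_dualizable_def by blast
qed

end
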